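(* Let $(X,\mathcal{B},\mu)$ be a standard probability space and let $\mathcal{R} \subset X \times X$ be a countable $\mu$-preserving equivalence relation. Suppose that $\tau:X \to X$ is a $\mathcal{B}$-measurable function such that $(x,\tau(x)) \in \mathcal{R}$ $\mu$-almost everywhere. For a $\mathcal{B}$-measurable function $f:X \to [0,+\infty]$ define $f_\tau:X \to [0,+\infty]$ by $$f_\tau(x) = \sum_{y \in \tau^{-1}(\{x\})}f(y).$$ Then $$\int_X f(x)\, d\mu(x)= \int_X f_\tau(x)\, d\mu(x).$$ In particular, taking $f \equiv 1$, $$\int_X \left| \tau^{-1}( \{x\}) \right| d\mu(x)=1.$$
   Context: Given a probability space $(X,\mathcal{B},\mu)$, a countable $\mu$-preserving equivalence relation is an equivalence relation $\mathcal{R} \in \mathcal{B} \otimes \mathcal{B}$ on $X$ with countable or finite equivalence classes (for every $x \in X$ the set $\{y \in X : (x,y) \in \mathcal{R}\}$ is at most countable), such that for any $A \in \mathcal{B}$ and any $\mathcal{B}$-measurable bijection $g:X \to X$ whose graph $\{(x,g(x)) : x \in X\}$ is contained in $\mathcal{R}$ we have $\mu(A)=\mu(g^{-1}(A))$.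
   Formalization: As (x,τ(x)) ∈ R is assumed only almost everywhere, τ could map the exceptional null set onto positive measure and break the formula; so fibres τ^{-1}({x}) are taken within any measurable conull set D on which (x,τ(x)) ∈ R always holds (D = X if it holds everywhere). *)

theory Defs
  imports "HOL-Analysis.Analysis" "HOL-Probability.Probability_Measure"
begin

definition standard_borel :: "'a measure \<Rightarrow> bool" where
  "standard_borel M \<longleftrightarrow>
     (\<exists>T. completely_metrizable_space T \<and> second_countable T \<and>
          topspace T = space M \<and> sets M = sigma_sets (topspace T) {U. openin T U})"

definition standard_prob_space :: "'a measure \<Rightarrow> bool" where
  "standard_prob_space M \<longleftrightarrow> prob_space M \<and> standard_borel M"

definition countable_mp_equiv :: "'a measure \<Rightarrow> ('a \<times> 'a) set \<Rightarrow> bool" where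
  "countable_mp_equiv M R \<longleftrightarrow>
     equiv (space M) R \<and>
     R \<in> sets (M \<Otimes>\<^sub>M M) \<and>
     (\<forall>x\<in>space M. countable {y \<in> space M. (x, y) \<in> R}) \<and>
     (\<forall>g. g \<in> M \<rightarrow>\<^sub>M M \<longrightarrow> bij_betw g (space M) (space M) \<longrightarrow>
          (\<forall>x\<in>space M. (x, g x) \<in> R) \<longrightarrow>
          (\<forall>A\<in>sets M. emeasure M A = emeasure M (g -` A \<inter> space M)))"

text \<open>
  The set \<open>D\<close> is the domain on which \<open>\<tau>\<close> is considered. For \<open>D = space M\<close> the two functions below
  are literally the sum of \<open>f\<close> over the fibre of \<open>\<tau>\<close> above \<open>x\<close> and the cardinality of that fibre.
  A map whose graph lies in the relation only almost everywhere has to be restricted to a conull \<open>D\<close>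
  on which this holds, as it may send the exceptional null set onto a set of positive measure.
  For example, let the measure be the uniform distribution on \<open>{0..1}\<close>, regarded as a measure on the
  real line, let the relation be equality, and let \<open>\<tau> x = x - 1\<close> for \<open>1 < x \<le> 2\<close> and \<open>\<tau> x = x\<close>
  elsewhere: almost every point of \<open>{0..1}\<close> has two preimages in the real line.
\<close>

definition fibre_sum :: "'a set \<Rightarrow> ('a \<Rightarrow> 'a) \<Rightarrow> ('a \<Rightarrow> ennreal) \<Rightarrow> 'a \<Rightarrow> ennreal" where
  "fibre_sum D \<tau> f x = (\<Sum>\<^sub>\<infinity>y\<in>\<tau> -` {x} \<inter> D. f y)"

text \<open>Counting measure, so that infinite fibres have cardinality \<open>\<infinity>\<close> rather than \<open>0\<close>.\<close>

definition fibre_card :: "'a set \<Rightarrow> ('a \<Rightarrow> 'a) \<Rightarrow> 'a \<Rightarrow> ennreal" where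
  "fibre_card D \<tau> x = emeasure (count_space UNIV) (\<tau> -` {x} \<inter> D)"

end

theory Submission
  imports Defs "HOL-Probability.Probability"
begin

text \<open>
  Suppose first that \<open>\<tau>\<close> is injective on a measurable set \<open>E\<close> and that its inverse is measurable on a
  measurable set \<open>Q \<subseteq> \<tau> ` E\<close>. Cutting \<open>E\<close> into countably many pieces that \<open>\<tau>\<close> either fixes pointwise
  or moves off themselves, each piece can be swapped with its image by an involution in the relation,
  so \<open>\<tau>\<close> preserves the measure. The theorem follows once the domain is, up to a null set with null
  image, a countable disjoint union of such sets.

  The theorems of Lusin--Souslin and Lusin--Novikov would provide this partition; here both are
  replaced by versions modulo null sets. (1) By Choquet's capacitability argument the image of a Borel
  set under a Borel map contains, up to a null set of a prescribed finite measure, a Borel set with a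
  Borel section. Applied to \<open>M\<close> this shows that \<open>\<tau>\<close> maps null sets to null sets; applied to the
  image measure it shows that the inverse of an injective restriction is measurable up to null sets.
  (2) Disintegrate the joint law of \<open>(\<tau> x, x)\<close> over its first coordinate. Since the fibres are
  countable, the conditional measures are carried by their atoms, and every atom carries more than
  half of the mass of some rational interval; the atoms are therefore covered by countably many
  measurable graphs, on each of which \<open>\<tau>\<close> is injective.
\<close>

subsection \<open>Borel sets as projections of closed sets\<close>

text \<open>Over a Polish space these are the analytic sets; \<open>nat \<Rightarrow> nat\<close>
  with its product topology serves as the Baire space.\<close>

definition closed_projection :: "'a::topological_space set \<Rightarrow> bool" where
  "closed_projection B \<longleftrightarrow> (\<exists>F :: ('a \<times> (nat \<Rightarrow> nat)) set. closed F \<and> B = fst ` F)"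

lemma closed_projection_closed:
  assumes "closed B"
  shows "closed_projection B"
  unfolding closed_projection_def
  by (rule exI[of _ "B \<times> UNIV"]) (use assms in \<open>auto intro: closed_Times\<close>)

lemma closed_nat_set: "closed (S :: nat set)"
  unfolding closed_def by (rule discrete_topology_class.open_discrete)

text \<open>A witness for the union is a stream whose head names the index \<open>n\<close> and
  whose tail is a witness for \<open>B n\<close>. The condition is closed because the head is a
  coordinate with discrete values.\<close>

lemma closed_projection_UN:
  fixes B :: "nat \<Rightarrow> 'a::topological_space set"
  assumes "\<And>n. closed_projection (B n)"
  shows "closed_projection (\<Union>n. B n)"
proof -
  obtain F :: "nat \<Rightarrow> ('a \<times> (nat \<Rightarrow> nat)) set"
    where F: "\<And>n. closed (F n)" "\<And>n. B n = fst ` F n"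
    using assms unfolding closed_projection_def by metis
  define G where "G = (\<Inter>n. {p. snd p 0 \<in> - {n}} \<union> (\<lambda>p. (fst p, \<lambda>i. snd p (Suc i))) -` F n)"
  have cont: "continuous_on UNIV (\<lambda>p :: 'a \<times> (nat \<Rightarrow> nat). snd p k)" for k
    by (rule continuous_on_product_then_coordinatewise[OF continuous_on_snd[OF continuous_on_id]])
  have "closed {p :: 'a \<times> (nat \<Rightarrow> nat). snd p 0 \<in> - {n}}" for n
    using closed_vimage[OF closed_nat_set cont[of 0], of "- {n}"] by (simp add: vimage_def)
  moreover have "closed ((\<lambda>p. (fst p, \<lambda>i. snd p (Suc i))) -` F n)" for n
    by (intro closed_vimage F continuous_on_Pair continuous_on_coordinatewise_then_product cont
        continuous_intros)
  ultimately have "closed G"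
    unfolding G_def by (intro closed_INT ballI closed_Un) auto
  moreover have "(\<Union>n. B n) = fst ` G"
  proof (intro equalityI subsetI)
    fix x assume "x \<in> (\<Union>n. B n)"
    then obtain n z where "(x, z) \<in> F n" by (auto simp: F(2))
    then have "(x, case_nat n z) \<in> G" by (auto simp: G_def)
    then show "x \<in> fst ` G" by force
  next
    fix x assume "x \<in> fst ` G"
    then obtain z where "(x, z) \<in> G" by force
    then have "(x, \<lambda>i. z (Suc i)) \<in> F (z 0)" by (auto simp: G_def)
    then show "x \<in> (\<Union>n. B n)" by (force simp: F(2))
  qed
  ultimately show ?thesis unfolding closed_projection_def by blast
qed

text \<open>By the pairing \<open>prod_encode\<close>, one stream stores witnesses for all
  \<open>B n\<close> at once.\<close>

lemma closed_projection_INT: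
  fixes B :: "nat \<Rightarrow> 'a::topological_space set"
  assumes "\<And>n. closed_projection (B n)"
  shows "closed_projection (\<Inter>n. B n)"
proof -
  obtain F :: "nat \<Rightarrow> ('a \<times> (nat \<Rightarrow> nat)) set"
    where F: "\<And>n. closed (F n)" "\<And>n. B n = fst ` F n"
    using assms unfolding closed_projection_def by metis
  define G where "G = (\<Inter>n. (\<lambda>p. (fst p, \<lambda>i. snd p (prod_encode (n, i)))) -` F n)"
  have cont: "continuous_on UNIV (\<lambda>p :: 'a \<times> (nat \<Rightarrow> nat). snd p k)" for k
    by (rule continuous_on_product_then_coordinatewise[OF continuous_on_snd[OF continuous_on_id]])
  have "closed G"
    unfolding G_def
    by (intro closed_INT ballI closed_vimage F continuous_on_Pair
        continuous_on_coordinatewise_then_product cont continuous_intros)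
  moreover have "(\<Inter>n. B n) = fst ` G"
  proof (intro equalityI subsetI)
    fix x assume "x \<in> (\<Inter>n. B n)"
    then have "\<forall>n. \<exists>z. (x, z) \<in> F n" by (fastforce simp: F(2))
    then obtain z where z: "\<And>n. (x, z n) \<in> F n" by metis
    have "(x, \<lambda>k. case prod_decode k of (n, i) \<Rightarrow> z n i) \<in> G" using z by (auto simp: G_def)
    then show "x \<in> fst ` G" by force
  next
    fix x assume "x \<in> fst ` G"
    then obtain z where "(x, z) \<in> G" by force
    then have "(x, \<lambda>i. z (prod_encode (n, i))) \<in> F n" for n by (auto simp: G_def)
    then show "x \<in> (\<Inter>n. B n)" by (force simp: F(2))
  qed
  ultimately show ?thesis unfolding closed_projection_def by blast
qed

text \<open>The sets which, together with their complements, are closed projections form a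
  sigma-algebra, by the two preceding closure properties. It makes both coordinate maps measurable,
  hence the identity, so it contains every Borel set.\<close>

lemma borel_closed_projection:
  fixes B :: "(real \<times> (nat \<Rightarrow> nat)) set"
  assumes "B \<in> sets borel"
  shows "closed_projection B"
proof -
  define \<A> :: "(real \<times> (nat \<Rightarrow> nat)) set set"
    where "\<A> = {B. closed_projection B \<and> closed_projection (- B)}"
  have "sigma_algebra UNIV \<A>"
    unfolding sigma_algebra_iff2
  proof (intro conjI ballI allI impI)
    show "{} \<in> \<A>"
      unfolding \<A>_def by (auto intro: closed_projection_closed)
    fix C :: "nat \<Rightarrow> (real \<times> (nat \<Rightarrow> nat)) set" assume "range C \<subseteq> \<A>"
    then show "(\<Union>i. C i) \<in> \<A>"
      unfolding \<A>_def by (auto intro!: closed_projection_UN closed_projection_INT)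
  next
    fix s assume "s \<in> \<A>"
    then show "UNIV - s \<in> \<A>"
      unfolding \<A>_def Compl_eq_Diff_UNIV[symmetric] by simp
  qed simp
  then have sets: "sets (sigma UNIV \<A>) = \<A>"
    by (rule sigma_algebra.sets_measure_of_eq)
  have space: "space (sigma UNIV \<A>) = UNIV" by simp
  have real: "fst \<in> sigma UNIV \<A> \<rightarrow>\<^sub>M borel"
    unfolding borel_measurable_iff_le
  proof
    fix a :: real
    have "closed {p :: real \<times> (nat \<Rightarrow> nat). fst p \<le> a}"
      by (intro closed_Collect_le continuous_intros)
    moreover have "closed {p :: real \<times> (nat \<Rightarrow> nat). a + 1 / Suc n \<le> fst p}" for n
      by (intro closed_Collect_le continuous_intros)
    \<comment> \<open>An open half-line is not closed, but it is a countable union of closed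
      ones.\<close>
    then have "closed_projection (\<Union>n. {p :: real \<times> (nat \<Rightarrow> nat). a + 1 / Suc n \<le> fst p})"
      by (intro closed_projection_UN closed_projection_closed)
    moreover have eq: "(\<Union>n. {p :: real \<times> (nat \<Rightarrow> nat). a + 1 / Suc n \<le> fst p}) = - {p. fst p \<le> a}"
    proof (intro equalityI subsetI)
      fix p :: "real \<times> (nat \<Rightarrow> nat)" assume "p \<in> - {p. fst p \<le> a}"
      then obtain n where "1 / Suc n < fst p - a"
        using reals_Archimedean[of "fst p - a"] by (auto simp: inverse_eq_divide)
      then show "p \<in> (\<Union>n. {p. a + 1 / Suc n \<le> fst p})" by (auto intro!: exI[of _ n])
    next
      fix p :: "real \<times> (nat \<Rightarrow> nat)" assume "p \<in> (\<Union>n. {p. a + 1 / Suc n \<le> fst p})"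
      then obtain n where "a + 1 / Suc n \<le> fst p" by auto
      moreover have "0 < 1 / real (Suc n)" by simp
      ultimately have "a < fst p" by linarith
      then show "p \<in> - {p. fst p \<le> a}" by simp
    qed
    ultimately have "{p. fst p \<le> a} \<in> \<A>"
      unfolding \<A>_def mem_Collect_eq eq by (blast intro: closed_projection_closed)
    then show "{p \<in> space (sigma UNIV \<A>). fst p \<le> a} \<in> sets (sigma UNIV \<A>)"
      by (simp add: sets)
  qed
  have "(\<lambda>p. snd p i) \<in> sigma UNIV \<A> \<rightarrow>\<^sub>M borel" for i
  proof (rule borel_measurableI)
    fix S :: "nat set"
    have cont: "continuous_on UNIV (\<lambda>p :: real \<times> (nat \<Rightarrow> nat). snd p i)"
      by (rule continuous_on_product_then_coordinatewise[OF continuous_on_snd[OF continuous_on_id]])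
    have "closed ((\<lambda>p :: real \<times> (nat \<Rightarrow> nat). snd p i) -` S)" for S
      by (rule closed_vimage[OF closed_nat_set cont])
    from this[of S] this[of "- S"] have "(\<lambda>p :: real \<times> (nat \<Rightarrow> nat). snd p i) -` S \<in> \<A>"
      unfolding \<A>_def mem_Collect_eq vimage_Compl by (blast intro: closed_projection_closed)
    then show "(\<lambda>p. snd p i) -` S \<inter> space (sigma UNIV \<A>) \<in> sets (sigma UNIV \<A>)"
      by (simp add: sets)
  qed
  then have "snd \<in> sigma UNIV \<A> \<rightarrow>\<^sub>M borel"
    by (intro measurable_coordinatewise_then_product)
  with real have "(\<lambda>p. (fst p, snd p)) \<in> sigma UNIV \<A> \<rightarrow>\<^sub>M borel \<Otimes>\<^sub>M borel"
    by (intro measurable_Pair)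
  then have "id \<in> sigma UNIV \<A> \<rightarrow>\<^sub>M (borel :: (real \<times> (nat \<Rightarrow> nat)) measure)"
    unfolding borel_prod by (simp add: id_def)
  from measurable_sets[OF this assms] have "B \<in> \<A>" by (simp add: sets space)
  then show ?thesis by (simp add: \<A>_def)
qed

text \<open>The given stream and its witness are merged into one, at even and odd positions
  respectively. Thus the closed set lives in a product with a single Baire space, as the selection
  argument expects.\<close>

lemma borel_eq_closed_projection_interleaved:
  fixes B :: "(real \<times> (nat \<Rightarrow> nat)) set"
  assumes "B \<in> sets borel"
  shows "\<exists>F. closed F \<and> B = (\<lambda>p. (fst p, \<lambda>i. snd p (2 * i))) ` F"
proof -
  obtain F :: "((real \<times> (nat \<Rightarrow> nat)) \<times> (nat \<Rightarrow> nat)) set" where F: "closed F" "B = fst ` F"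
    using borel_closed_projection[OF assms] unfolding closed_projection_def by auto
  define G where "G = (\<lambda>p. ((fst p, \<lambda>i. snd p (2 * i)), \<lambda>i. snd p (Suc (2 * i)))) -` F"
  have cont: "continuous_on UNIV (\<lambda>p :: real \<times> (nat \<Rightarrow> nat). snd p k)" for k
    by (rule continuous_on_product_then_coordinatewise[OF continuous_on_snd[OF continuous_on_id]])
  have "closed G"
    unfolding G_def
    by (intro closed_vimage F continuous_on_Pair
        continuous_on_coordinatewise_then_product cont continuous_intros)
  moreover have "B = (\<lambda>p. (fst p, \<lambda>i. snd p (2 * i))) ` G"
  proof (intro equalityI subsetI)
    fix x assume "x \<in> B"
    then obtain z where z: "(x, z) \<in> F" by (auto simp: F(2))
    define w where "w = (\<lambda>i. if even i then snd x (i div 2) else z (i div 2))"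
    have "(fst x, w) \<in> G" using z by (simp add: G_def w_def)
    then show "x \<in> (\<lambda>p. (fst p, \<lambda>i. snd p (2 * i))) ` G"
      by (rule rev_image_eqI) (simp add: w_def)
  qed (auto simp: F(2) G_def intro: rev_image_eqI)
  ultimately show ?thesis by blast
qed

subsection \<open>Measurable selection up to null sets\<close>

text \<open>Points of \<open>F\<close> whose projections approach \<open>y\<close> and which obey
  more and more of the bounds have streams in one compact product. A convergent subsequence yields a
  point of the closed set \<open>F\<close> over \<open>y\<close> that obeys all bounds.\<close>

lemma closure_projection_bounded:
  fixes F :: "('a::metric_space \<times> (nat \<Rightarrow> nat)) set" and k :: "nat \<Rightarrow> nat"
  assumes F: "closed F"
    and y: "\<And>n. y \<in> closure (fst ` {p \<in> F. \<forall>i<n. snd p i \<le> k i})"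
  shows "y \<in> fst ` {p \<in> F. \<forall>i. snd p i \<le> k i}"
proof -
  have "\<exists>p\<in>F. (\<forall>i<n. snd p i \<le> k i) \<and> dist (fst p) y < inverse (Suc n)" for n
  proof -
    have "inverse (real (Suc n)) > 0" by simp
    with y[of n] show ?thesis unfolding closure_approachable by blast
  qed
  then have "\<forall>n. \<exists>p. p \<in> F \<and> (\<forall>i<n. snd p i \<le> k i) \<and> dist (fst p) y < inverse (Suc n)"
    by blast
  from choice[OF this] obtain p where p: "\<And>n. p n \<in> F" "\<And>n i. i < n \<Longrightarrow> snd (p n) i \<le> k i"
      and dist: "\<And>n. dist (fst (p n)) y < inverse (Suc n)"
    by blast
  \<comment> \<open>Coordinate \<open>i\<close> of \<open>p n\<close> obeys the bound
    \<open>k i\<close> as soon as \<open>i < n\<close>; the finitely many exceptions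
    \<open>n \<le> i\<close> are absorbed by the sum.\<close>
  define M where "M i = k i + (\<Sum>n\<le>i. snd (p n) i)" for i
  have "snd (p n) i \<le> M i" for n i
  proof (cases "i < n")
    case True
    then show ?thesis using p(2)[OF True] by (simp add: M_def)
  next
    case False
    then have "snd (p n) i \<le> (\<Sum>n\<le>i. snd (p n) i)"
      by (intro member_le_sum) auto
    then show ?thesis by (simp add: M_def)
  qed
  then have PiE: "snd (p n) \<in> (\<Pi>\<^sub>E i\<in>UNIV. {..M i})" for n by auto
  have "compactin (product_topology (\<lambda>i. euclidean) UNIV) (\<Pi>\<^sub>E i\<in>UNIV. {..M i})"
    unfolding compactin_PiE by (auto intro: finite_imp_compact)
  then have "seq_compact (\<Pi>\<^sub>E i\<in>UNIV. {..M i})"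
    by (simp add: euclidean_product_topology compact_imp_seq_compact)
  from seq_compactE[OF this, of "\<lambda>n. snd (p n)", OF allI[OF PiE]]
  obtain z r where r: "strict_mono r" and "((\<lambda>n. snd (p n)) \<circ> r) \<longlonglongrightarrow> z" .
  then have z: "(\<lambda>n. snd (p (r n))) \<longlonglongrightarrow> z" by (simp add: comp_def)
  have "(\<lambda>n. dist (fst (p n)) y) \<longlonglongrightarrow> 0"
    by (rule Lim_null_comparison[OF _ LIMSEQ_inverse_real_of_nat])
      (use dist in \<open>auto intro!: always_eventually less_imp_le\<close>)
  then have "(\<lambda>n. fst (p n)) \<longlonglongrightarrow> y" by (rule tendsto_dist_iff[THEN iffD2])
  then have "(\<lambda>n. (fst (p (r n)), snd (p (r n)))) \<longlonglongrightarrow> (y, z)"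
    using LIMSEQ_subseq_LIMSEQ[OF _ r] z unfolding comp_def by (intro tendsto_Pair) simp_all
  then have lim: "(\<lambda>n. p (r n)) \<longlonglongrightarrow> (y, z)" by simp
  have "(y, z) \<in> F"
    using closed_sequentially[OF F _ lim] p(1) by blast
  moreover have "z i \<le> k i" for i
  proof -
    have "continuous_on UNIV (\<lambda>x :: nat \<Rightarrow> nat. x i)" by simp
    then have "(\<lambda>n. snd (p (r n)) i) \<longlonglongrightarrow> z i"
      using continuous_on_tendsto_compose[OF _ z, of UNIV "\<lambda>x. x i"] by simp
    moreover have "eventually (\<lambda>n. snd (p (r n)) i \<le> k i) sequentially"
      using eventually_gt_at_top[of i]
    proof eventually_elim
      case (elim n)
      then have "i < r n" using seq_suble[OF r, of n] by simp
      then show ?case by (rule p(2))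
    qed
    ultimately show ?thesis by (rule tendsto_upperbound) simp
  qed
  ultimately show ?thesis by (intro image_eqI[of _ _ "(y, z)"]) auto
qed

text \<open>The projection along a compact factor preserves closedness; unbounded streams would give
  arbitrary analytic sets.\<close>

lemma closed_projection_bounded:
  fixes F :: "('a::metric_space \<times> (nat \<Rightarrow> nat)) set" and k :: "nat \<Rightarrow> nat"
  assumes "closed F"
  shows "closed (fst ` {p \<in> F. \<forall>i. snd p i \<le> k i})"
proof -
  have "closure (fst ` {p \<in> F. \<forall>i. snd p i \<le> k i})
      \<subseteq> closure (fst ` {p \<in> F. \<forall>i<n. snd p i \<le> k i})" for n
    by (intro closure_mono image_mono) auto
  then have "closure (fst ` {p \<in> F. \<forall>i. snd p i \<le> k i}) \<subseteq> fst ` {p \<in> F. \<forall>i. snd p i \<le> k i}"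
    by (intro subsetI closure_projection_bounded[OF assms]) blast
  then show ?thesis by (simp only: closure_subset_eq)
qed

lemma closed_cylinder:
  "closed {p :: 'a::topological_space \<times> (nat \<Rightarrow> nat). snd p i \<in> S}"
proof -
  have "closed ((\<lambda>p :: 'a \<times> (nat \<Rightarrow> nat). snd p i) -` S)"
    by (rule closed_vimage[OF closed_nat_set
          continuous_on_product_then_coordinatewise[OF continuous_on_snd[OF continuous_on_id]]])
  then show ?thesis by (simp add: vimage_def)
qed

section \<open>Measurable choice of streams and exhaustion by bounded parts\<close>

text \<open>Over each \<open>y\<close> the lexicographically least stream is built digit by digit,
  keeping the current prefix extendable to a member of \<open>C\<close>. Borel measurability of the
  sets of prefixes makes each digit measurable, and closedness of \<open>C\<close> puts the limit
  stream into \<open>C\<close>.\<close>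

lemma lexicographic_selection:
  fixes C :: "('a::topological_space \<times> (nat \<Rightarrow> nat)) set"
  assumes C: "closed C"
    and meas: "\<And>t. fst ` {p \<in> C. map (snd p) [0..<length t] = t} \<in> sets borel"
  shows "\<exists>s \<in> borel \<rightarrow>\<^sub>M borel. \<forall>y \<in> fst ` C. (y, s y) \<in> C"
proof -
  define D where "D t = fst ` {p \<in> C. map (snd p) [0..<length t] = t}" for t
  have [measurable]: "D t \<in> sets borel" for t using meas by (simp add: D_def)
  define L where "L y = rec_nat [] (\<lambda>_ t. t @ [LEAST j. y \<in> D (t @ [j])])" for y
  define s where "s y n = (LEAST j. y \<in> D (L y n @ [j]))" for y n
  have L: "L y 0 = []" "L y (Suc n) = L y n @ [s y n]" for y n
    by (simp_all add: L_def s_def)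
  have L_map: "L y n = map (s y) [0..<n]" for y n
    by (induction n) (simp_all add: L)
  have step: "(\<lambda>y. LEAST j. y \<in> D (t @ [j])) \<in> borel \<rightarrow>\<^sub>M count_space UNIV" for t
    by measurable
  have "(\<lambda>y. L y n) \<in> borel \<rightarrow>\<^sub>M count_space UNIV" for n
  proof (induction n)
    case (Suc n)
    \<comment> \<open>There are only countably many prefixes \<open>t\<close>, so a measurable
      choice of \<open>t\<close> may be substituted into a family of measurable functions.\<close>
    have "(\<lambda>y. (\<lambda>t y. t @ [LEAST j. y \<in> D (t @ [j])]) (L y n) y) \<in> borel \<rightarrow>\<^sub>M count_space UNIV"
      by (rule measurable_compose_countable[OF _ Suc]) (use step in measurable)
    then show ?case by (simp add: L s_def)
  qed (simp add: L)
  then have "(\<lambda>y. (\<lambda>t y. LEAST j. y \<in> D (t @ [j])) (L y n) y) \<in> borel \<rightarrow>\<^sub>M count_space UNIV" for n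
    by (rule measurable_compose_countable[OF step])
  then have "(\<lambda>y. s y n) \<in> borel \<rightarrow>\<^sub>M count_space UNIV" for n
    by (simp add: s_def)
  then have "(\<lambda>y. s y n) \<in> borel \<rightarrow>\<^sub>M borel" for n
    by (rule measurable_compose) simp
  then have s: "s \<in> borel \<rightarrow>\<^sub>M borel"
    by (rule measurable_coordinatewise_then_product)
  have "(y, s y) \<in> C" if "y \<in> fst ` C" for y
  proof -
    have "y \<in> D (L y n)" for n
    proof (induction n)
      case 0
      then show ?case using that by (simp add: L D_def)
    next
      case (Suc n)
      then obtain z where z: "(y, z) \<in> C" "map z [0..<length (L y n)] = L y n"
        by (auto simp: D_def)
      then have "y \<in> D (L y n @ [z n])"
        by (force simp: D_def L_map)
      then show ?case unfolding L s_def by (rule LeastI)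
    qed
    then have "\<forall>n. \<exists>z. (y, z) \<in> C \<and> map z [0..<n] = map (s y) [0..<n]"
      by (force simp: D_def L_map)
    then obtain z where z: "\<And>n. (y, z n) \<in> C" "\<And>n. map (z n) [0..<n] = map (s y) [0..<n]"
      by metis
    have "z n i = s y i" if "i < n" for n i
      using z(2)[of n] that by auto
    then have "(\<lambda>n. z n i) \<longlonglongrightarrow> s y i" for i
      by (intro tendsto_eventually eventually_sequentiallyI[of "Suc i"]) auto
    then have "z \<longlonglongrightarrow> s y"
      using limitin_componentwise[of "\<lambda>_. euclidean" UNIV z "s y" sequentially]
      by (simp add: euclidean_product_topology)
    then have "(\<lambda>n. (y, z n)) \<longlonglongrightarrow> (y, s y)" by (intro tendsto_intros)
    with z(1) show ?thesis by (meson C closed_sequentially)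
  qed
  with s show ?thesis by blast
qed

text \<open>
  Choquet's capacitability argument: the coordinates are bounded one after the other, each time losing
  so little outer measure that it stays above \<open>r\<close>.
\<close>

lemma bounded_projection_approx:
  fixes F :: "('a::metric_space \<times> (nat \<Rightarrow> nat)) set"
  assumes F: "closed F" and "finite_measure \<mu>" and \<mu>: "sets \<mu> = sets borel"
    and r: "r < outer_measure_of \<mu> (fst ` F)"
  shows "\<exists>k. r \<le> emeasure \<mu> (fst ` {p \<in> F. \<forall>i. snd p i \<le> (k i :: nat)})"
proof -
  interpret finite_measure \<mu> by fact
  note [measurable_cong] = \<mu>
  have space: "space \<mu> = UNIV" using sets_eq_imp_space_eq[OF \<mu>] by simp
  have step: "\<exists>m. r < outer_measure_of \<mu> (fst ` {p \<in> Z. snd p n \<le> m})"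
    if "r < outer_measure_of \<mu> (fst ` Z)" for Z :: "('a \<times> (nat \<Rightarrow> nat)) set" and n
  proof -
    \<comment> \<open>Outer measure is continuous along increasing sequences of arbitrary sets; the
      projections involved here need not be Borel.\<close>
    have "(SUP m. outer_measure_of \<mu> (fst ` {p \<in> Z. snd p n \<le> m}))
        = outer_measure_of \<mu> (\<Union>m. fst ` {p \<in> Z. snd p n \<le> m})"
      by (rule SUP_outer_measure_of_incseq) (force simp: space incseq_def)+
    also have "(\<Union>m. fst ` {p \<in> Z. snd p n \<le> m}) = fst ` Z" by blast
    finally have "r < (SUP m. outer_measure_of \<mu> (fst ` {p \<in> Z. snd p n \<le> m}))"
      using that by simp
    then show ?thesis unfolding less_SUP_iff by blast
  qed
  have "\<exists>Z. \<forall>n. (r < outer_measure_of \<mu> (fst ` Z n) \<and> (n = 0 \<longrightarrow> Z n = F))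
      \<and> (\<exists>m. Z (Suc n) = {p \<in> Z n. snd p n \<le> m})"
  proof (rule dependent_nat_choice)
    show "\<exists>Z. r < outer_measure_of \<mu> (fst ` Z) \<and> (0 = (0::nat) \<longrightarrow> Z = F)"
      using r by blast
    fix Z :: "('a \<times> (nat \<Rightarrow> nat)) set" and n :: nat
    assume "r < outer_measure_of \<mu> (fst ` Z) \<and> (n = 0 \<longrightarrow> Z = F)"
    then show "\<exists>Z'. (r < outer_measure_of \<mu> (fst ` Z') \<and> (Suc n = 0 \<longrightarrow> Z' = F))
        \<and> (\<exists>m. Z' = {p \<in> Z. snd p n \<le> m})"
      using step[of Z n] by blast
  qed
  then obtain Z where Z': "\<And>n. r < outer_measure_of \<mu> (fst ` Z n) \<and> (n = 0 \<longrightarrow> Z n = F)"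
      "\<And>n. \<exists>m. Z (Suc n) = {p \<in> Z n. snd p n \<le> m}"
    by blast
  have Z0: "Z 0 = F" and r_less: "r < outer_measure_of \<mu> (fst ` Z n)" for n
    using Z'(1) by simp_all
  obtain k where k: "\<forall>n. Z (Suc n) = {p \<in> Z n. snd p n \<le> k n}"
    using choice[OF allI[OF Z'(2)]] ..
  then have ZSuc: "Z (Suc n) = {p \<in> Z n. snd p n \<le> k n}" for n ..
  have Z: "Z n = {p \<in> F. \<forall>i<n. snd p i \<le> k i}" for n
    by (induction n) (auto simp: Z0 ZSuc less_Suc_eq)
  \<comment> \<open>Closures are Borel and keep measure at least \<open>r\<close>. By compactness
    their intersection lies in the projection of the part of \<open>F\<close> obeying all bounds, so
    continuity from above gives the claim.\<close>
  define A where "A n = closure (fst ` Z n)" for n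
  have A[measurable]: "A n \<in> sets \<mu>" for n
    by (simp add: A_def \<mu>)
  have "r \<le> emeasure \<mu> (A n)" for n
  proof -
    have "r \<le> outer_measure_of \<mu> (A n)"
      using r_less[of n] outer_measure_of_mono[OF closure_subset, of \<mu> "fst ` Z n"]
      unfolding A_def by (rule order.strict_implies_order[OF order.strict_trans2])
    then show ?thesis by (simp only: outer_measure_of_eq[OF A])
  qed
  moreover have "decseq A"
    unfolding A_def decseq_Suc_iff by (intro allI closure_mono image_mono) (auto simp: ZSuc)
  then have "(INF n. emeasure \<mu> (A n)) = emeasure \<mu> (\<Inter>n. A n)"
    by (intro INF_emeasure_decseq) auto
  ultimately have "r \<le> emeasure \<mu> (\<Inter>n. A n)"
    by (metis INF_greatest)
  also have "(\<Inter>n. A n) \<subseteq> fst ` {p \<in> F. \<forall>i. snd p i \<le> k i}"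
    by (intro subsetI closure_projection_bounded[OF F]) (simp add: A_def Z)
  then have "emeasure \<mu> (\<Inter>n. A n) \<le> emeasure \<mu> (fst ` {p \<in> F. \<forall>i. snd p i \<le> k i})"
    by (rule emeasure_mono) (simp add: \<mu> borel_closed closed_projection_bounded[OF F])
  finally show ?thesis by blast
qed

text \<open>Bounded parts of \<open>F\<close> have closed projections, also after fixing a prefix,
  so lexicographic selection applies to them. Their projections exhaust the outer measure of the
  projection of \<open>F\<close>, and countably many of the selections are glued.\<close>

lemma measurable_selection:
  fixes F :: "('a::metric_space \<times> (nat \<Rightarrow> nat)) set"
  assumes F: "closed F" and "finite_measure \<mu>" and \<mu>: "sets \<mu> = sets borel"
  shows "\<exists>Q\<in>sets borel. \<exists>s \<in> borel \<rightarrow>\<^sub>M borel. \<exists>N\<in>null_sets \<mu>.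
    (\<forall>y\<in>Q. (y, s y) \<in> F) \<and> fst ` F \<subseteq> Q \<union> N"
proof -
  interpret finite_measure \<mu> by fact
  note [measurable_cong] = \<mu>
  have space: "space \<mu> = UNIV" using sets_eq_imp_space_eq[OF \<mu>] by simp
  \<comment> \<open>\<open>E\<close> is a measurable hull; the exceptional set will be the part of
    it not covered by the selections.\<close>
  obtain E where E: "E \<in> sets \<mu>" "fst ` F \<subseteq> E" "outer_measure_of \<mu> (fst ` F) = emeasure \<mu> E"
    using outer_measure_of_attain[of "fst ` F" \<mu>] by (auto simp: space)
  have "\<exists>Q s. Q \<in> sets borel \<and> s \<in> borel \<rightarrow>\<^sub>M borel \<and> (\<forall>y\<in>Q. (y, s y) \<in> F)
      \<and> emeasure \<mu> E \<le> emeasure \<mu> Q + ennreal (1 / Suc n)" for n :: nat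
  \<comment> \<open>Subtracting \<open>1 / Suc n\<close> lowers the measure strictly only if it is
    positive.\<close>
  proof (cases "emeasure \<mu> E = 0")
    case True
    then show ?thesis by (intro exI[of _ "{}"] exI[of _ "\<lambda>_ _. 0"]) auto
  next
    case False
    then have "emeasure \<mu> E - ennreal (1 / Suc n) < outer_measure_of \<mu> (fst ` F)"
      unfolding E(3) by (intro ennreal_between) (auto simp: less_top[symmetric] zero_less_iff_neq_zero)
    then obtain k where k: "emeasure \<mu> E - ennreal (1 / Suc n)
        \<le> emeasure \<mu> (fst ` {p \<in> F. \<forall>i. snd p i \<le> k i})"
      using bounded_projection_approx[OF F assms(2) \<mu>] by blast
    define C where "C = {p \<in> F. \<forall>i. snd p i \<le> k i}"
    have "C = F \<inter> (\<Inter>i. {p. snd p i \<in> {..k i}})" by (auto simp: C_def)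
    then have "closed C"
      by (simp only:) (intro closed_Int closed_INT ballI F closed_cylinder)
    moreover have "fst ` {p \<in> C. map (snd p) [0..<length t] = t} \<in> sets borel" for t
    proof -
      have "closed (F \<inter> (\<Inter>i\<in>{..<length t}. {p. snd p i \<in> {t ! i}}))"
        by (intro closed_Int closed_INT ballI F closed_cylinder)
      from borel_closed[OF closed_projection_bounded[OF this, of k]]
      moreover have "map (snd p) [0..<length t] = t \<longleftrightarrow> (\<forall>i<length t. snd p i = t ! i)"
        for p :: "'a \<times> (nat \<Rightarrow> nat)"
        using map_eq_conv[of "snd p" "[0..<length t]" "(!) t"] unfolding map_nth by auto
      then have "{p \<in> C. map (snd p) [0..<length t] = t}
          = {p \<in> F \<inter> (\<Inter>i\<in>{..<length t}. {p. snd p i \<in> {t ! i}}). \<forall>i. snd p i \<le> k i}"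
        by (auto simp: C_def)
      ultimately show ?thesis by simp
    qed
    ultimately obtain s where "s \<in> borel \<rightarrow>\<^sub>M borel" "\<forall>y \<in> fst ` C. (y, s y) \<in> C"
      using lexicographic_selection by blast
    moreover have "fst ` C \<in> sets borel"
      unfolding C_def by (intro borel_closed closed_projection_bounded F)
    moreover have "emeasure \<mu> E \<le> emeasure \<mu> (fst ` C) + ennreal (1 / Suc n)"
      using k by (simp add: C_def ennreal_minus_le_iff add.commute)
    ultimately show ?thesis by (intro exI[of _ "fst ` C"] exI[of _ s]) (auto simp: C_def)
  qed
  then obtain Q s where Q[measurable]: "\<And>n. Q n \<in> sets borel"
      and s: "\<And>n. s n \<in> borel \<rightarrow>\<^sub>M borel"
      and sF: "\<And>n y. y \<in> Q n \<Longrightarrow> (y, s n y) \<in> F"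
      and approx: "\<And>n. emeasure \<mu> E \<le> emeasure \<mu> (Q n) + ennreal (1 / Suc n)"
    by metis
  \<comment> \<open>Where several selections are available the first one is used; each of them has
    values in \<open>F\<close>, so any measurable choice of index would do.\<close>
  define t where "t y = s (LEAST n. y \<in> Q n) y" for y
  have "t \<in> borel \<rightarrow>\<^sub>M borel"
    unfolding t_def by (rule measurable_compose_countable[OF s]) measurable
  moreover have "(y, t y) \<in> F" if "y \<in> (\<Union>n. Q n)" for y
    using that unfolding t_def by (auto intro: sF LeastI)
  moreover have "E - (\<Union>n. Q n) \<in> null_sets \<mu>"
  proof -
    have Q\<mu>: "(\<Union>n. Q n) \<in> sets \<mu>" by measurable
    have sub: "(\<Union>n. Q n) \<subseteq> E"
    proof
      fix y assume "y \<in> (\<Union>n. Q n)"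
      then obtain n where "y \<in> Q n" by blast
      from imageI[OF sF[OF this], of fst] E(2) show "y \<in> E" by auto
    qed
    have "emeasure \<mu> E \<le> emeasure \<mu> (\<Union>n. Q n) + ennreal (1 / Suc n)" for n
      using approx[of n] emeasure_mono[of "Q n" "\<Union>n. Q n" \<mu>] Q\<mu>
      by (meson UN_upper UNIV_I add_right_mono order_trans)
    moreover have "(\<lambda>n. emeasure \<mu> (\<Union>n. Q n) + ennreal (1 / Suc n))
        \<longlonglongrightarrow> emeasure \<mu> (\<Union>n. Q n) + ennreal 0"
      using LIMSEQ_inverse_real_of_nat
      by (intro tendsto_add tendsto_const tendsto_ennrealI) (simp add: inverse_eq_divide)
    ultimately have "emeasure \<mu> E \<le> emeasure \<mu> (\<Union>n. Q n)"
      by (intro LIMSEQ_le_const[of "\<lambda>n. emeasure \<mu> (\<Union>n. Q n) + ennreal (1 / Suc n)"]) simp_all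
    then have "emeasure \<mu> (E - (\<Union>n. Q n)) = 0"
      using emeasure_Diff[OF _ E(1) Q\<mu> sub] by (simp add: diff_eq_0_iff_ennreal less_top[symmetric])
    then show ?thesis using E(1) Q\<mu> by auto
  qed
  ultimately show ?thesis using E(2)
    by (intro bexI[of _ "\<Union>n. Q n"] bexI[of _ t] bexI[of _ "E - (\<Union>n. Q n)"]) auto
qed

text \<open>
  All that is used of a standard Borel space: a measurable injection into the reals and a measurable
  parametrization by the Baire space.
\<close>

locale coded_borel_space =
  fixes M :: "'a measure" and h :: "'a \<Rightarrow> real" and p :: "(nat \<Rightarrow> nat) \<Rightarrow> 'a"
  assumes h_measurable[measurable]: "h \<in> M \<rightarrow>\<^sub>M borel"
    and h_inj: "inj_on h (space M)"
    and h_bounds: "0 \<le> h x" "h x \<le> 1"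
    and p_measurable[measurable]: "p \<in> borel \<rightarrow>\<^sub>M M"
    and p_onto: "space M \<subseteq> range p"
begin

section \<open>Selections for maps on the coded space\<close>

lemma h_eq_iff: "x \<in> space M \<Longrightarrow> y \<in> space M \<Longrightarrow> h x = h y \<longleftrightarrow> x = y"
  using h_inj by (auto dest: inj_onD)

text \<open>Pulled back along \<open>p\<close>, the graph of \<phi> on \<open>E\<close> becomes a
  Borel set of pairs of a real and a code. It comes from a closed set of interleaved streams; the
  even digits of a selected stream form a code of the wanted preimage.\<close>

lemma selection_real:
  fixes \<phi> :: "'a \<Rightarrow> real"
  assumes "finite_measure \<mu>" and \<mu>: "sets \<mu> = sets borel"
    and E[measurable]: "E \<in> sets M" and \<phi>[measurable]: "\<phi> \<in> M \<rightarrow>\<^sub>M borel"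
  shows "\<exists>Q\<in>sets borel. \<exists>s \<in> borel \<rightarrow>\<^sub>M M. \<exists>N\<in>null_sets \<mu>.
    (\<forall>t\<in>Q. s t \<in> E \<and> \<phi> (s t) = t) \<and> \<phi> ` E \<subseteq> Q \<union> N"
proof -
  define G where "G = {g :: real \<times> (nat \<Rightarrow> nat). p (snd g) \<in> E \<and> \<phi> (p (snd g)) = fst g}"
  have "{g \<in> space (borel \<Otimes>\<^sub>M borel). p (snd g) \<in> E \<and> \<phi> (p (snd g)) = fst g}
      \<in> sets (borel \<Otimes>\<^sub>M borel)"
    by measurable
  then have "G \<in> sets (borel \<Otimes>\<^sub>M borel)"
    by (simp add: G_def space_pair_measure)
  then have "G \<in> sets borel" unfolding borel_prod .
  then obtain F where F: "closed F" "G = (\<lambda>g. (fst g, \<lambda>i. snd g (2 * i))) ` F"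
    using borel_eq_closed_projection_interleaved by blast
  obtain Q s N where Q: "Q \<in> sets borel" and s[measurable]: "s \<in> borel \<rightarrow>\<^sub>M borel"
      and N: "N \<in> null_sets \<mu>"
      and sF: "\<And>y. y \<in> Q \<Longrightarrow> (y, s y) \<in> F" and cover: "fst ` F \<subseteq> Q \<union> N"
    using measurable_selection[OF F(1) assms(1) \<mu>] by auto
  have "(\<lambda>t. s t (2 * i)) \<in> borel \<rightarrow>\<^sub>M borel" for i
    by (rule measurable_compose[OF s measurable_product_coordinates])
  then have "(\<lambda>t i. s t (2 * i)) \<in> borel \<rightarrow>\<^sub>M borel"
    by (rule measurable_coordinatewise_then_product)
  then have meas: "(\<lambda>t. p (\<lambda>i. s t (2 * i))) \<in> borel \<rightarrow>\<^sub>M M"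
    by (rule measurable_compose) measurable
  have "(t, \<lambda>i. s t (2 * i)) \<in> G" if "t \<in> Q" for t
    unfolding F(2) by (rule image_eqI[OF _ sF[OF that]]) simp
  then have sel: "\<forall>t\<in>Q. p (\<lambda>i. s t (2 * i)) \<in> E \<and> \<phi> (p (\<lambda>i. s t (2 * i))) = t"
    by (simp add: G_def)
  have "\<phi> ` E \<subseteq> fst ` F"
  proof
    fix t assume "t \<in> \<phi> ` E"
    then obtain x where x: "x \<in> E" "t = \<phi> x" by blast
    then obtain z where "x = p z"
      using p_onto sets.sets_into_space[OF E] by blast
    with x have "(t, z) \<in> G" by (simp add: G_def)
    then have "fst (t, z) \<in> fst ` G" by (rule imageI)
    then show "t \<in> fst ` F" by (simp add: F(2) image_image)
  qed
  with cover have "\<phi> ` E \<subseteq> Q \<union> N" by simp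
  with sel Q N meas show ?thesis
    by (intro bexI[of _ Q] bexI[of _ "\<lambda>t. p (\<lambda>i. s t (2 * i))"] bexI[of _ N] conjI)
qed

text \<open>This is the real-valued version for \<open>h\<close> composed with \<tau>, relative to
  the image of \<rho> under \<open>h\<close>; injectivity of \<open>h\<close> turns equality of
  codes back into equality of points.\<close>

lemma selection:
  assumes "finite_measure \<rho>" and \<rho>: "sets \<rho> = sets M"
    and E[measurable]: "E \<in> sets M" and \<tau>[measurable]: "\<tau> \<in> M \<rightarrow>\<^sub>M M"
  shows "\<exists>Q\<in>sets M. \<exists>s \<in> M \<rightarrow>\<^sub>M M. \<exists>N\<in>null_sets \<rho>.
    (\<forall>y\<in>Q. s y \<in> E \<and> \<tau> (s y) = y) \<and> \<tau> ` E \<subseteq> Q \<union> N"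
proof -
  interpret finite_measure \<rho> by fact
  note [measurable_cong] = \<rho>
  have space: "space \<rho> = space M" using sets_eq_imp_space_eq[OF \<rho>] .
  have h\<rho>: "h \<in> \<rho> \<rightarrow>\<^sub>M borel" by measurable
  have "finite_measure (distr \<rho> borel h)" by (rule finite_measure_distr[OF h\<rho>])
  then obtain Q s N where Q[measurable]: "Q \<in> sets borel" and s[measurable]: "s \<in> borel \<rightarrow>\<^sub>M M"
      and N: "N \<in> null_sets (distr \<rho> borel h)"
      and sel: "\<And>t. t \<in> Q \<Longrightarrow> s t \<in> E" "\<And>t. t \<in> Q \<Longrightarrow> h (\<tau> (s t)) = t"
      and cover: "(\<lambda>x. h (\<tau> x)) ` E \<subseteq> Q \<union> N"
    using selection_real[of "distr \<rho> borel h" E "\<lambda>x. h (\<tau> x)"] by auto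
  have sub: "E \<subseteq> space M" by (rule sets.sets_into_space[OF E])
  show ?thesis
  proof (intro bexI conjI ballI)
    show "h -` Q \<inter> space M \<in> sets M" by measurable
    show "(\<lambda>x. s (h x)) \<in> M \<rightarrow>\<^sub>M M" by measurable
    show "h -` N \<inter> space M \<in> null_sets \<rho>"
      using N null_sets_distr_iff[OF h\<rho>] by (simp add: space)
    fix y assume y: "y \<in> h -` Q \<inter> space M"
    then show "s (h y) \<in> E" using sel(1) by simp
    then have "\<tau> (s (h y)) \<in> space M" using sub measurable_space[OF \<tau>] by blast
    moreover have "h (\<tau> (s (h y))) = h y" using sel(2) y by simp
    ultimately show "\<tau> (s (h y)) = y" using y h_eq_iff by simp
  next
    show "\<tau> ` E \<subseteq> (h -` Q \<inter> space M) \<union> (h -` N \<inter> space M)"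
      using cover sub measurable_space[OF \<tau>] by auto
  qed
qed

end

subsection \<open>Partial isomorphisms inside the relation\<close>

locale coded_mp_equiv = coded_borel_space M h p + prob_space M
  for M :: "'a measure" and h p +
  fixes R :: "('a \<times> 'a) set"
  assumes mp_equiv: "countable_mp_equiv M R"
begin

text \<open>Swapping \<open>A\<close> and \<open>B\<close> and fixing all other points gives a
  measurable involution inside \<open>R\<close>, and this bijection of the whole space pulls
  \<open>A\<close> back to \<open>B\<close>.\<close>

lemma emeasure_disjoint_iso:
  assumes [measurable]: "A \<in> sets M" "B \<in> sets M" "\<phi> \<in> M \<rightarrow>\<^sub>M M" "\<psi> \<in> M \<rightarrow>\<^sub>M M"
    and A: "\<And>x. x \<in> A \<Longrightarrow> \<phi> x \<in> B \<and> \<psi> (\<phi> x) = x \<and> (x, \<phi> x) \<in> R"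
    and B: "\<And>y. y \<in> B \<Longrightarrow> \<psi> y \<in> A \<and> \<phi> (\<psi> y) = y"
    and disj: "A \<inter> B = {}"
  shows "emeasure M A = emeasure M B"
proof -
  have R: "equiv (space M) R"
    and mp: "\<And>g A. g \<in> M \<rightarrow>\<^sub>M M \<Longrightarrow> bij_betw g (space M) (space M) \<Longrightarrow>
      (\<forall>x\<in>space M. (x, g x) \<in> R) \<Longrightarrow> A \<in> sets M \<Longrightarrow> emeasure M A = emeasure M (g -` A \<inter> space M)"
    using mp_equiv unfolding countable_mp_equiv_def by blast+
  have sub: "A \<subseteq> space M" "B \<subseteq> space M" by (simp_all add: sets.sets_into_space)
  define g where "g x = (if x \<in> A then \<phi> x else if x \<in> B then \<psi> x else x)" for x
  have inv: "g x \<in> space M" "g (g x) = x" if "x \<in> space M" for x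
    using that A[of x] B[of x] sub disj by (auto simp: g_def)
  have "g \<in> M \<rightarrow>\<^sub>M M" unfolding g_def by measurable
  moreover have "bij_betw g (space M) (space M)"
    by (rule bij_betw_byWitness[of _ g]) (use inv in auto)
  moreover have "(x, g x) \<in> R" if x: "x \<in> space M" for x
  proof -
    have "(\<psi> x, x) \<in> R" if "x \<in> B" using A[of "\<psi> x"] B[OF that] by simp
    then show ?thesis
      using A[of x] x R by (auto simp: g_def equiv_def refl_on_def dest: symD)
  qed
  ultimately have "emeasure M A = emeasure M (g -` A \<inter> space M)" by (intro mp) simp_all
  also have "g -` A \<inter> space M = B"
    using A B disj sub by (auto simp: g_def split: if_splits)
  finally show ?thesis .
qed

text \<open>When \<open>A\<close> and \<open>B\<close> overlap the swap is not well defined, so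
  \<open>A\<close> is cut into countably many pieces that are either fixed pointwise or disjoint
  from their images.\<close>

lemma emeasure_iso:
  assumes A_sets[measurable]: "A \<in> sets M" and B_sets[measurable]: "B \<in> sets M"
    and [measurable]: "\<phi> \<in> M \<rightarrow>\<^sub>M M" "\<psi> \<in> M \<rightarrow>\<^sub>M M"
    and A: "\<And>x. x \<in> A \<Longrightarrow> \<phi> x \<in> B \<and> \<psi> (\<phi> x) = x \<and> (x, \<phi> x) \<in> R"
    and B: "\<And>y. y \<in> B \<Longrightarrow> \<psi> y \<in> A \<and> \<phi> (\<psi> y) = y"
  shows "emeasure M A = emeasure M B"
proof -
  have sub: "A \<subseteq> space M" "B \<subseteq> space M" by (simp_all add: sets.sets_into_space)
  \<comment> \<open>\<open>None\<close> collects the fixed points, recognised by their codes. In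
    \<open>Some (r, b)\<close> the rational \<open>r\<close> separates the codes of \<open>x\<close>
    and \<phi> \<open>x\<close>, and \<open>b\<close> tells on which side \<open>x\<close> lies;
    such a set is disjoint from its image.\<close>
  define C :: "(rat \<times> bool) option \<Rightarrow> 'a set" where
    "C i = (case i of None \<Rightarrow> {x \<in> space M. x \<in> A \<and> h (\<phi> x) = h x}
      | Some (r, b) \<Rightarrow> {x \<in> space M. x \<in> A \<and> (h x \<le> of_rat r \<longleftrightarrow> b) \<and> (h (\<phi> x) \<le> of_rat r \<longleftrightarrow> \<not> b)})" for i
  have [measurable]: "C i \<in> sets M" for i
    unfolding C_def by (cases i) (auto split: prod.split)
  define D where "D = disjointed (\<lambda>n. C (from_nat n))"
  have D[measurable]: "D n \<in> sets M" for n
    unfolding D_def using sets.range_disjointed_sets[of "\<lambda>n. C (from_nat n)" M] by (simp add: image_subset_iff)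
  have D_sub: "D n \<subseteq> C (from_nat n)" for n
    unfolding D_def by (rule disjointed_subset)
  have C_sub: "C i \<subseteq> A" for i by (auto simp: C_def split: option.splits)
  have "A \<subseteq> (\<Union>i. C i)"
  proof
    fix x assume x: "x \<in> A"
    then have xs: "x \<in> space M" using sub by blast
    show "x \<in> (\<Union>i. C i)"
    proof (cases "h (\<phi> x)" "h x" rule: linorder_cases)
      case less
      then obtain r where "h (\<phi> x) < of_rat r" "of_rat r < h x" using of_rat_dense by blast
      then have "x \<in> C (Some (r, False))" using x xs by (simp add: C_def)
      then show ?thesis by blast
    next
      case equal
      then have "x \<in> C None" using x xs by (simp add: C_def)
      then show ?thesis by blast
    next
      case greater
      then obtain r where "h x < of_rat r" "of_rat r < h (\<phi> x)" using of_rat_dense by blast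
      then have "x \<in> C (Some (r, True))" using x xs by (simp add: C_def)
      then show ?thesis by blast
    qed
  qed
  also have "(\<Union>i. C i) \<subseteq> (\<Union>n. C (from_nat n))"
  proof
    fix x assume "x \<in> (\<Union>i. C i)"
    then obtain i where "x \<in> C i" by blast
    then have "x \<in> C (from_nat (to_nat i))" by simp
    then show "x \<in> (\<Union>n. C (from_nat n))" by blast
  qed
  also have "(\<Union>n. C (from_nat n)) = (\<Union>n. D n)"
    unfolding D_def by (rule UN_disjointed_eq[symmetric])
  finally have "A \<subseteq> (\<Union>n. D n)" .
  moreover have "D n \<subseteq> A" for n using D_sub C_sub by blast
  ultimately have UN_D: "(\<Union>n. D n) = A" by blast
  define D' where "D' n = \<psi> -` D n \<inter> B" for n
  have D'_eq: "D' n = {x \<in> space M. \<psi> x \<in> D n \<and> x \<in> B}" for n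
    using sub by (auto simp: D'_def)
  have [measurable]: "D' n \<in> sets M" for n
    unfolding D'_eq by measurable
  have piece: "emeasure M (D n) = emeasure M (D' n)" for n
  proof (cases "from_nat n :: (rat \<times> bool) option")
    case None
    have "\<phi> x = x" if "x \<in> D n" for x
    proof -
      have "x \<in> C None" using that D_sub[of n] unfolding None by blast
      then have "x \<in> A" "h (\<phi> x) = h x" by (auto simp: C_def)
      then show ?thesis using A[of x] sub h_eq_iff[of "\<phi> x" x] by blast
    qed
    then have "D' n = D n"
      using A B \<open>D n \<subseteq> A\<close> by (fastforce simp: D'_def)
    then show ?thesis by simp
  next
    case (Some i)
    obtain r b where i: "i = (r, b)" by (cases i)
    have Dn: "(h x \<le> of_rat r \<longleftrightarrow> b) \<and> (h (\<phi> x) \<le> of_rat r \<longleftrightarrow> \<not> b)" if "x \<in> D n" for x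
      using D_sub[of n] that unfolding Some i C_def by auto
    show ?thesis
    proof (rule emeasure_disjoint_iso[of _ _ \<phi> \<psi>])
      show "D n \<inter> D' n = {}"
      proof (intro equals0I)
        fix x assume "x \<in> D n \<inter> D' n"
        then show False using Dn[of x] Dn[of "\<psi> x"] B[of x] by (auto simp: D'_def)
      qed
      show "\<phi> x \<in> D' n \<and> \<psi> (\<phi> x) = x \<and> (x, \<phi> x) \<in> R" if "x \<in> D n" for x
        using that A[of x] \<open>D n \<subseteq> A\<close> by (auto simp: D'_def)
      show "\<psi> y \<in> D n \<and> \<phi> (\<psi> y) = y" if "y \<in> D' n" for y
        using that B[of y] by (simp add: D'_def)
    qed measurable
  qed
  have disj: "disjoint_family D" unfolding D_def by (rule disjoint_family_disjointed)
  then have disj': "disjoint_family D'" by (auto simp: disjoint_family_on_def D'_def)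
  have "B = (\<Union>n. D' n)" using UN_D B by (auto simp: D'_def)
  then have "emeasure M B = (\<Sum>n. emeasure M (D' n))"
    using suminf_emeasure[of D' M] disj' by (simp add: image_subset_iff)
  also have "\<dots> = (\<Sum>n. emeasure M (D n))" by (simp add: piece)
  also have "\<dots> = emeasure M A"
    using suminf_emeasure[of D M] disj UN_D by (simp add: image_subset_iff)
  finally show ?thesis by simp
qed

end

subsection \<open>Disintegration and countable sections\<close>

text \<open>This is a conditional distribution function of the second coordinate given the first.
  Conditional probabilities of rational half-lines are only countably many functions, so they can be
  corrected on one null set and then regularised from the right.\<close>

lemma conditional_cdf:
  fixes L :: "(real \<times> real) measure"
  assumes "prob_space L" and L: "sets L = sets (borel \<Otimes>\<^sub>M borel)"
    and bounds: "AE z in L. 0 \<le> snd z \<and> snd z \<le> 1"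
  obtains F :: "real \<Rightarrow> real \<Rightarrow> real"
  where "\<And>t. (\<lambda>u. F u t) \<in> borel_measurable borel"
    and "\<And>u s t. s \<le> t \<Longrightarrow> F u s \<le> F u t"
    and "\<And>u t. continuous (at_right t) (F u)"
    and "\<And>u t. t < 0 \<Longrightarrow> F u t = 0"
    and "\<And>u t. 1 \<le> t \<Longrightarrow> F u t = 1"
    and "\<And>A t. A \<in> sets borel \<Longrightarrow>
      (\<integral>z. indicator A (fst z) * F (fst z) t \<partial>L) = measure L (A \<times> {..t})"
proof -
  interpret prob_space L by fact
  note [measurable_cong] = L
  have space: "space L = UNIV" using sets_eq_imp_space_eq[OF L] by (simp add: space_pair_measure)
  define V :: "(real \<times> real) measure" where "V = vimage_algebra UNIV fst borel"
  have sets_V: "sets V = {fst -` A | A. A \<in> sets borel}"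
    unfolding V_def by (subst sets_vimage_algebra2) auto
  have rect: "A \<times> B \<in> sets L" if "A \<in> sets borel" "B \<in> sets borel" for A B
    using that unfolding L by (rule pair_measureI)
  have fst_vimage: "fst -` A = A \<times> UNIV" for A :: "real set" by auto
  have "sets V \<subseteq> sets L" unfolding sets_V fst_vimage by (auto intro: rect)
  then interpret V: finite_measure_subalgebra L V
    by unfold_locales (simp add: subalgebra_def space V_def)
  \<comment> \<open>Sets in \<open>V\<close> are unions of vertical lines, so a
    \<open>V\<close>-measurable function is constant along each line and may be read off at
    \<open>(u, 0)\<close>.\<close>
  have V_fst: "f z = f (fst z, 0)" if "f \<in> borel_measurable V" for f :: "real \<times> real \<Rightarrow> real" and z
  proof -
    have "f -` {f z} \<inter> space V \<in> sets V" using that by measurable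
    then obtain A where "f -` {f z} \<inter> space V = fst -` A" unfolding sets_V by blast
    then have "f -` {f z} = fst -` A" by (simp add: V_def)
    moreover have "z \<in> f -` {f z}" by simp
    ultimately have "(fst z, 0) \<in> f -` {f z}" by simp
    then show ?thesis by simp
  qed
  define I where "I q z = (indicator (UNIV \<times> {..of_rat q}) z :: real)" for q :: rat and z :: "real \<times> real"
  have I: "integrable L (I q)" for q
    unfolding I_def by (intro integrable_real_indicator rect) (auto simp: emeasure_eq_measure)
  define b where "b q u = real_cond_exp L V (I q) (u, 0)" for q u
  have b_eq: "real_cond_exp L V (I q) z = b q (fst z)" for q z
    unfolding b_def by (rule V_fst) simp
  have [measurable]: "b q \<in> borel_measurable borel" for q
  proof -
    have "(\<lambda>u. (u, 0)) \<in> borel \<rightarrow>\<^sub>M V"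
      unfolding V_def by (rule measurable_vimage_algebra2) auto
    then show ?thesis
      unfolding b_def by (rule measurable_compose) simp
  qed
  define g where "g u \<longleftrightarrow> (\<forall>q. 0 \<le> b q u \<and> b q u \<le> 1) \<and> (\<forall>q r. q \<le> r \<longrightarrow> b q u \<le> b r u)" for u
  have [measurable]: "Measurable.pred borel g" unfolding g_def by measurable
  have g: "AE z in L. g (fst z)"
  proof -
    have "AE z in L. 0 \<le> b q (fst z) \<and> b q (fst z) \<le> 1" for q
      using V.real_cond_exp_ge_c[OF I, of 0 q] V.real_cond_exp_le_c[OF I, of q 1]
      by (auto simp: b_eq I_def indicator_def)
    moreover have "AE z in L. q \<le> r \<longrightarrow> b q (fst z) \<le> b r (fst z)" for q r
    proof (cases "q \<le> r")
      case True
      then have "AE z in L. I q z \<le> I r z"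
        by (intro AE_I2) (auto simp: I_def indicator_def of_rat_less_eq intro: order_trans)
      from V.real_cond_exp_mono[OF this I I] show ?thesis by (simp add: b_eq)
    qed simp
    ultimately show ?thesis unfolding g_def by (simp add: AE_all_countable)
  qed
  \<comment> \<open>The values outside \<open>[0, 1]\<close> are forced, and for bad
    \<open>u\<close> the function drops to a point mass, so that bounds and monotonicity hold for
    every \<open>u\<close>.\<close>
  define c where "c q u = (if q < 0 then 0 else if 1 < q then 1 else if g u then b q u else 0)" for q u
  have [measurable]: "c q \<in> borel_measurable borel" for q unfolding c_def by measurable
  have c_bounds: "0 \<le> c q u" "c q u \<le> 1" for q u by (auto simp: c_def g_def)
  have c_mono: "c q u \<le> c r u" if "q \<le> r" for q r u
    using that by (auto simp: c_def g_def)
  have c_int: "(\<integral>z. indicator A (fst z) * c q (fst z) \<partial>L) = measure L (A \<times> {..of_rat q})"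
    if A[measurable]: "A \<in> sets borel" for A q
  proof -
    have fA: "fst -` A \<in> sets V" using A unfolding sets_V by blast
    consider "q < 0" | "1 < q" | "0 \<le> q" "q \<le> 1" by linarith
    then show ?thesis
    proof cases
      case 1
      have "AE z in L. z \<notin> A \<times> {..of_rat q}"
        using bounds by eventually_elim (use 1 in \<open>auto simp: mem_Times_iff of_rat_less_0_iff dest: order_trans\<close>)
      then have "measure L (A \<times> {..of_rat q}) = 0"
        using AE_iff_measurable[OF rect[OF A, of "{..of_rat q}"], of "\<lambda>z. z \<notin> A \<times> {..of_rat q}"]
        by (simp add: space measure_def)
      then show ?thesis using 1 by (simp add: c_def)
    next
      case 2
      then have "1 < (of_rat q :: real)" by simp
      from bounds have "AE z in L. z \<in> A \<times> {..of_rat q} \<longleftrightarrow> z \<in> A \<times> UNIV"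
      proof eventually_elim
        case (elim z)
        with \<open>1 < (of_rat q :: real)\<close> have "snd z \<le> of_rat q" by linarith
        then show ?case by (simp add: mem_Times_iff)
      qed
      then have "measure L (A \<times> {..of_rat q}) = measure L (A \<times> UNIV)"
        by (intro finite_measure_eq_AE rect) auto
      also have "\<dots> = (\<integral>z. indicator (A \<times> UNIV) z \<partial>L)"
        using rect[of A UNIV] by (simp add: space)
      also have "\<dots> = (\<integral>z. indicator A (fst z) * c q (fst z) \<partial>L)"
        using 2 by (intro Bochner_Integration.integral_cong) (auto simp: c_def indicator_def mem_Times_iff)
      finally show ?thesis by simp
    next
      case 3
      have "(\<integral>z. indicator A (fst z) * c q (fst z) \<partial>L)
          = (\<integral>z. indicator (fst -` A) z *\<^sub>R real_cond_exp L V (I q) z \<partial>L)"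
        using g 3 by (intro integral_cong_AE)
          (auto simp: b_eq c_def indicator_def elim!: eventually_mono)
      also have "\<dots> = (\<integral>z. indicator (fst -` A) z *\<^sub>R I q z \<partial>L)"
        using V.real_cond_exp_intA[OF I fA, of q] by (simp add: set_lebesgue_integral_def)
      also have "\<dots> = (\<integral>z. indicator (A \<times> {..of_rat q}) z \<partial>L)"
        by (intro Bochner_Integration.integral_cong) (auto simp: I_def indicator_def)
      also have "\<dots> = measure L (A \<times> {..of_rat q})"
        using rect[of A "{..of_rat q}"] by (simp add: space)
      finally show ?thesis .
    qed
  qed
  \<comment> \<open>The strict inequality yields right-continuity. It also yields the value 1
    already at \<open>t = 1\<close>, although \<open>c 1 u\<close> is not forced.\<close>
  define F :: "real \<Rightarrow> real \<Rightarrow> real" where "F u t = (INF q\<in>{q. t < of_rat q}. c q u)" for u t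
  have ne: "{q :: rat. t < of_rat q} \<noteq> {}" for t :: real
    using of_rat_dense[of t "t + 1"] by auto
  have bdd: "bdd_below ((\<lambda>q. c q u) ` S)" for u S
    using c_bounds by (intro bdd_belowI[of _ 0]) auto
  have F_le: "F u t \<le> c q u" if "t < of_rat q" for u t q
    unfolding F_def using that by (intro cINF_lower bdd) simp
  have F_ge: "x \<le> F u t" if "\<And>q. t < of_rat q \<Longrightarrow> x \<le> c q u" for u t x
    unfolding F_def using that by (intro cINF_greatest ne) simp
  have F_less: "\<exists>q. t < of_rat q \<and> c q u < x" if "F u t < x" for u t x
    using that unfolding F_def cINF_less_iff[OF ne bdd] by auto
  have F_bounds: "0 \<le> F u t" "F u t \<le> 1" for u t
  proof -
    show "0 \<le> F u t" by (rule F_ge) (rule c_bounds)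
    obtain q where "t < of_rat q" using ne by blast
    from order_trans[OF F_le[OF this] c_bounds(2)] show "F u t \<le> 1" .
  qed
  have F_meas[measurable]: "(\<lambda>u. F u t) \<in> borel_measurable borel" for t
    unfolding F_def by (intro borel_measurable_cINF_real) auto
  have F_mono: "F u s \<le> F u t" if "s \<le> t" for u s t
    by (rule F_ge, rule F_le) (use that in simp)
  show thesis
  proof (rule that[of F])
    show "(\<lambda>u. F u t) \<in> borel_measurable borel" for t by (rule F_meas)
    show "F u s \<le> F u t" if "s \<le> t" for u s t using that by (rule F_mono)
    show "continuous (at_right t) (F u)" for u t
    proof -
      have "\<exists>d>0. F u (t + d) - F u t < e" if e: "0 < e" for e
      proof -
        obtain q where q: "t < of_rat q" "c q u < F u t + e"
          using F_less[of u t "F u t + e"] e by auto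
        have "t + (of_rat q - t) / 2 < of_rat q" using q(1) by (simp add: field_simps)
        then have "F u (t + (of_rat q - t) / 2) \<le> c q u" by (rule F_le)
        with q show ?thesis by (intro exI[of _ "(of_rat q - t) / 2"]) auto
      qed
      then have "\<forall>e>0. \<exists>d>0. F u (t + d) - F u t < e" by simp
      moreover have "continuous (at_right t) (F u) \<longleftrightarrow> (\<forall>e>0. \<exists>d>0. F u (t + d) - F u t < e)"
        by (rule continuous_at_right_real_increasing) (rule F_mono)
      ultimately show ?thesis by simp
    qed
    show "F u t = 0" if t: "t < 0" for u t
    proof -
      obtain q where "t < of_rat q" "of_rat q < (0 :: real)" using of_rat_dense[OF t] by (elim exE conjE)
      then have "F u t \<le> 0" using F_le[of t q u] by (simp add: c_def)
      then show ?thesis using F_bounds(1)[of u t] by simp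
    qed
    show "F u t = 1" if "1 \<le> t" for u t
    proof -
      have "1 \<le> c q u" if "t < of_rat q" for q
      proof -
        have "(1 :: real) < of_rat q" using that \<open>1 \<le> t\<close> by linarith
        then show ?thesis by (simp add: c_def)
      qed
      then have "1 \<le> F u t" by (rule F_ge)
      then show ?thesis using F_bounds(2)[of u t] by simp
    qed
    fix A :: "real set" and t :: real assume A[measurable]: "A \<in> sets borel"
    \<comment> \<open>Rationals approach \<open>t\<close> from above. The integrals converge to the
      left-hand side by dominated convergence, and to the right-hand side between the measures of
      \<open>{..t}\<close> and \<open>{..t + 1 / real (Suc n)}\<close>.\<close>
    have "\<exists>q. t < of_rat q \<and> of_rat q < t + 1 / real (Suc n)" for n
      by (rule of_rat_dense) simp
    then have "\<forall>n. \<exists>q. t < of_rat q \<and> of_rat q < t + 1 / real (Suc n)" by simp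
    from choice[OF this] obtain q
      where "\<forall>n. t < of_rat (q n) \<and> of_rat (q n) < t + 1 / real (Suc n)" ..
    then have q: "t < of_rat (q n)" "of_rat (q n) < t + 1 / real (Suc n)" for n by simp_all
    have inv_lim: "(\<lambda>n. t + 1 / real (Suc n)) \<longlonglongrightarrow> t + 0"
      using LIMSEQ_inverse_real_of_nat by (intro tendsto_intros) (simp add: inverse_eq_divide)
    then have inv_lim': "(\<lambda>n. t + 1 / real (Suc n)) \<longlonglongrightarrow> t" by simp
    have q_lim: "(\<lambda>n. of_rat (q n)) \<longlonglongrightarrow> t"
      by (rule tendsto_sandwich[OF _ _ tendsto_const inv_lim'])
        (simp_all add: less_imp_le[OF q(1)] less_imp_le[OF q(2)] del: of_nat_Suc)
    have c_lim: "(\<lambda>n. c (q n) u) \<longlonglongrightarrow> F u t" for u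
    proof (rule order_tendstoI)
      fix x assume "x < F u t"
      then show "\<forall>\<^sub>F n in sequentially. x < c (q n) u"
        using F_le[OF q(1)] by (intro always_eventually allI) (rule less_le_trans)
    next
      fix x assume "F u t < x"
      then obtain r where r: "t < of_rat r" "c r u < x" using F_less by blast
      have "\<forall>\<^sub>F n in sequentially. of_rat (q n) < (of_rat r :: real)"
        using q_lim r(1) by (rule order_tendstoD)
      then show "\<forall>\<^sub>F n in sequentially. c (q n) u < x"
      proof eventually_elim
        case (elim n)
        then have "c (q n) u \<le> c r u" by (intro c_mono) (simp add: of_rat_less)
        with r(2) show ?case by simp
      qed
    qed
    have "(\<lambda>n. \<integral>z. indicator A (fst z) * c (q n) (fst z) \<partial>L)
        \<longlonglongrightarrow> (\<integral>z. indicator A (fst z) * F (fst z) t \<partial>L)"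
      by (rule integral_dominated_convergence[where w = "\<lambda>_. 1"])
        (use c_bounds c_lim in \<open>auto simp: indicator_def intro!: tendsto_mult\<close>)
    moreover have "(\<lambda>n. \<integral>z. indicator A (fst z) * c (q n) (fst z) \<partial>L) \<longlonglongrightarrow> measure L (A \<times> {..t})"
    proof (rule tendsto_sandwich)
      show "\<forall>\<^sub>F n in sequentially. measure L (A \<times> {..t}) \<le> (\<integral>z. indicator A (fst z) * c (q n) (fst z) \<partial>L)"
        unfolding c_int[OF A]
        by (intro always_eventually allI finite_measure_mono rect Sigma_mono)
          (simp_all add: less_imp_le[OF q(1)])
      show "\<forall>\<^sub>F n in sequentially. (\<integral>z. indicator A (fst z) * c (q n) (fst z) \<partial>L)
          \<le> measure L (A \<times> {..t + 1 / real (Suc n)})"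
        unfolding c_int[OF A]
        by (intro always_eventually allI finite_measure_mono rect Sigma_mono)
          (simp_all add: less_imp_le[OF q(2)] del: of_nat_Suc)
      have "(\<lambda>n. measure L (A \<times> {..t + 1 / real (Suc n)})) \<longlonglongrightarrow> measure L (\<Inter>n. A \<times> {..t + 1 / real (Suc n)})"
      proof (rule finite_Lim_measure_decseq)
        show "range (\<lambda>n. A \<times> {..t + 1 / real (Suc n)}) \<subseteq> sets L" by (auto intro: rect)
        have "t + 1 / real (Suc n) \<le> t + 1 / real (Suc m)" if "m \<le> n" for m n
          using that by (simp add: frac_le)
        then show "decseq (\<lambda>n. A \<times> {..t + 1 / real (Suc n)})"
          by (intro antimonoI Sigma_mono) (simp_all only: atMost_subset_iff order_refl)
      qed
      moreover have "(\<Inter>n. A \<times> {..t + 1 / real (Suc n)}) = A \<times> {..t}"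
      proof -
        have "v \<le> t" if "\<forall>n. v \<le> t + 1 / real (Suc n)" for v
          using LIMSEQ_le_const[OF inv_lim, of v] that by simp
        moreover have "v \<le> t + 1 / real (Suc n)" if "v \<le> t" for v n
          using that by (simp add: add_increasing2)
        ultimately have "(\<forall>n. v \<le> t + 1 / real (Suc n)) \<longleftrightarrow> v \<le> t" for v by iprover
        then show ?thesis by (simp only: set_eq_iff INT_iff mem_Times_iff atMost_iff) simp
      qed
      ultimately show "(\<lambda>n. measure L (A \<times> {..t + 1 / real (Suc n)})) \<longlonglongrightarrow> measure L (A \<times> {..t})"
        by simp
    qed simp
    ultimately show "(\<integral>z. indicator A (fst z) * F (fst z) t \<partial>L) = measure L (A \<times> {..t})"
      by (rule LIMSEQ_unique)
  qed
qed

text \<open>The kernel consists of the Stieltjes measures of the conditional distribution functions.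
  The integral identity holds for products with half-lines by construction and extends by Dynkin's
  argument.\<close>

lemma disintegration:
  fixes L :: "(real \<times> real) measure"
  assumes "prob_space L" and L: "sets L = sets (borel \<Otimes>\<^sub>M borel)"
    and bounds: "AE z in L. 0 \<le> snd z \<and> snd z \<le> 1"
  obtains K :: "real \<Rightarrow> real measure"
  where "\<And>u. prob_space (K u)" and "\<And>u. sets (K u) = sets borel"
    and "\<And>B. B \<in> sets borel \<Longrightarrow> (\<lambda>u. emeasure (K u) B) \<in> borel_measurable borel"
    and "\<And>H. H \<in> sets (borel \<Otimes>\<^sub>M borel) \<Longrightarrow>
      (\<integral>\<^sup>+z. emeasure (K (fst z)) (Pair (fst z) -` H) \<partial>L) = emeasure L H"
    and "\<And>H. H \<in> sets (borel \<Otimes>\<^sub>M borel) \<Longrightarrow>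
      (\<lambda>u. emeasure (K u) (Pair u -` H)) \<in> borel_measurable borel"
proof -
  interpret prob_space L by fact
  note [measurable_cong] = L
  have space: "space L = UNIV" using sets_eq_imp_space_eq[OF L] by (simp add: space_pair_measure)
  obtain F :: "real \<Rightarrow> real \<Rightarrow> real"
    where F_meas[measurable]: "\<And>t. (\<lambda>u. F u t) \<in> borel_measurable borel"
    and F_mono: "\<And>u s t. s \<le> t \<Longrightarrow> F u s \<le> F u t"
    and F_cont: "\<And>u t. continuous (at_right t) (F u)"
    and F_0: "\<And>u t. t < 0 \<Longrightarrow> F u t = 0"
    and F_1: "\<And>u t. 1 \<le> t \<Longrightarrow> F u t = 1"
    and F_int: "\<And>A t. A \<in> sets borel \<Longrightarrow>
      (\<integral>z. indicator A (fst z) * F (fst z) t \<partial>L) = measure L (A \<times> {..t})"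
    using conditional_cdf[OF assms] by blast
  have F_bounds: "0 \<le> F u t" "F u t \<le> 1" for u t
    using F_mono[of "min t (-1)" t u] F_0[of "min t (-1)" u] F_mono[of t "max t 1" u] F_1[of "max t 1" u]
    by auto
  have F_bot: "(F u \<longlongrightarrow> 0) at_bot" for u
    by (rule tendsto_eventually) (use F_0 in \<open>auto simp: eventually_at_bot_dense\<close>)
  have F_top: "(F u \<longlongrightarrow> 1) at_top" for u
    by (rule tendsto_eventually) (use F_1 in \<open>auto simp: eventually_at_top_linorder\<close>)
  define K where "K u = interval_measure (F u)" for u
  have K: "prob_space (K u)" for u
    using real_distribution_interval_measure[of "F u", OF F_mono F_cont F_bot F_top]
    by (simp add: K_def real_distribution_def)
  have sets_K[measurable_cong]: "sets (K u) = sets borel" for u by (simp add: K_def)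
  have space_K: "space (K u) = UNIV" for u by (simp add: K_def)
  have K_Iic: "emeasure (K u) {..t} = ennreal (F u t)" for u t
    unfolding K_def by (rule emeasure_interval_measure_Iic[of "F u", OF F_mono F_cont F_bot])
  \<comment> \<open>Measurability and the integral identity are carried together, because the
    differences and series of integrals below require measurable integrands.\<close>
  define P where "P H \<longleftrightarrow> H \<in> sets L \<and> (\<lambda>u. emeasure (K u) (Pair u -` H)) \<in> borel_measurable borel
    \<and> (\<integral>\<^sup>+z. emeasure (K (fst z)) (Pair (fst z) -` H) \<partial>L) = emeasure L H" for H
  have slice: "Pair u -` H \<in> sets (K u)" if "H \<in> sets L" for u H
    using that unfolding sets_K L by (rule sets_Pair1)
  have P_empty: "P {}" by (simp add: P_def)
  have P_diff: "P (H - H')" if H: "P H" and H': "P H'" and sub: "H' \<subseteq> H" for H H'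
  proof -
    have sets: "H \<in> sets L" "H' \<in> sets L" using H H' by (simp_all add: P_def)
    have [measurable]: "(\<lambda>u. emeasure (K u) (Pair u -` H)) \<in> borel_measurable borel"
        "(\<lambda>u. emeasure (K u) (Pair u -` H')) \<in> borel_measurable borel"
      using H H' by (simp_all add: P_def)
    have eq: "emeasure (K u) (Pair u -` (H - H')) = emeasure (K u) (Pair u -` H) - emeasure (K u) (Pair u -` H')" for u
    proof -
      interpret K: prob_space "K u" by (rule K)
      show ?thesis unfolding vimage_Diff
        by (rule emeasure_Diff) (use sub in \<open>auto intro: slice sets simp: K.emeasure_eq_measure\<close>)
    qed
    have fin: "(\<integral>\<^sup>+z. emeasure (K (fst z)) (Pair (fst z) -` H') \<partial>L) \<noteq> \<infinity>"
      using H' by (simp add: P_def emeasure_eq_measure)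
    have le: "emeasure (K u) (Pair u -` H') \<le> emeasure (K u) (Pair u -` H)" for u
      using sub by (intro emeasure_mono vimage_mono slice sets)
    have "(\<integral>\<^sup>+z. emeasure (K (fst z)) (Pair (fst z) -` (H - H')) \<partial>L)
        = (\<integral>\<^sup>+z. emeasure (K (fst z)) (Pair (fst z) -` H) \<partial>L)
        - (\<integral>\<^sup>+z. emeasure (K (fst z)) (Pair (fst z) -` H') \<partial>L)"
      unfolding eq by (intro nn_integral_diff fin AE_I2 le) measurable
    also have "\<dots> = emeasure L (H - H')"
      using H H' by (subst emeasure_Diff) (auto simp: P_def sub emeasure_eq_measure)
    finally show ?thesis using sets unfolding P_def eq by auto
  qed
  have P_UN: "P (\<Union>i. H i)" if P: "\<And>i :: nat. P (H i)" and disj: "disjoint_family H" for H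
  proof -
    have sets[measurable]: "H i \<in> sets L" for i using P by (simp add: P_def)
    have [measurable]: "(\<lambda>u. emeasure (K u) (Pair u -` H i)) \<in> borel_measurable borel" for i
      using P by (simp add: P_def)
    have eq: "emeasure (K u) (Pair u -` (\<Union>i. H i)) = (\<Sum>i. emeasure (K u) (Pair u -` H i))" for u
      unfolding vimage_UN
      by (rule suminf_emeasure[symmetric])
        (use disj in \<open>auto intro: slice sets simp: disjoint_family_on_def\<close>)
    have "(\<integral>\<^sup>+z. emeasure (K (fst z)) (Pair (fst z) -` (\<Union>i. H i)) \<partial>L) = (\<Sum>i. emeasure L (H i))"
      unfolding eq using P by (subst nn_integral_suminf) (auto simp: P_def)
    also have "\<dots> = emeasure L (\<Union>i. H i)"
      using sets by (intro suminf_emeasure disj) auto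
    finally show ?thesis unfolding P_def eq using sets by auto
  qed
  have P_Iic: "P (A \<times> {..t})" if A[measurable]: "A \<in> sets borel" for A t
  proof -
    have eq: "emeasure (K u) (Pair u -` (A \<times> {..t})) = ennreal (indicator A u * F u t)" for u
    proof -
      have "Pair u -` (A \<times> {..t}) = (if u \<in> A then {..t} else {})" by auto
      then show ?thesis by (simp add: K_Iic)
    qed
    have "(\<integral>\<^sup>+z. emeasure (K (fst z)) (Pair (fst z) -` (A \<times> {..t})) \<partial>L)
        = ennreal (\<integral>z. indicator A (fst z) * F (fst z) t \<partial>L)"
      unfolding eq
    proof (rule nn_integral_eq_integral)
      show "integrable L (\<lambda>z. indicator A (fst z) * F (fst z) t)"
        by (rule integrable_const_bound[of _ 1]) (auto simp: indicator_def F_bounds)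
    qed (simp add: F_bounds)
    moreover have "A \<times> {..t} \<in> sets L" unfolding L by measurable
    ultimately show ?thesis
      unfolding P_def eq by (simp add: F_int emeasure_eq_measure)
  qed
  have Iic_stable: "Int_stable (range (\<lambda>t :: real. {..t}))"
    by (auto simp: Int_stable_def)
  have borel_Iic: "sets (borel :: real measure) = sigma_sets UNIV (range (\<lambda>t. {..t}))"
    unfolding borel_eq_atMost by (rule sets_measure_of) simp
  have P_UNIV: "P (A \<times> UNIV)" if A[measurable]: "A \<in> sets borel" for A
  proof -
    have eq: "emeasure (K u) (Pair u -` (A \<times> UNIV)) = indicator A u" for u
    proof -
      have "Pair u -` (A \<times> UNIV) = (if u \<in> A then space (K u) else {})" by (auto simp: space_K)
      then show ?thesis using prob_space.emeasure_space_1[OF K] by simp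
    qed
    have sets: "A \<times> UNIV \<in> sets L" unfolding L by measurable
    have "(\<integral>\<^sup>+z. indicator A (fst z) \<partial>L) = (\<integral>\<^sup>+z. indicator (A \<times> UNIV) z \<partial>L)"
      by (intro nn_integral_cong) (auto simp: indicator_def)
    also have "\<dots> = emeasure L (A \<times> UNIV)" using sets by simp
    finally show ?thesis using sets unfolding P_def eq by simp
  qed
  have P_rect: "P (A \<times> B)" if A: "A \<in> sets borel" and B: "B \<in> sets borel" for A B
  proof -
    \<comment> \<open>The first of two inductions: \<open>A\<close> stays fixed and \<open>B\<close>
      is generated by half-lines. The second one starts from all measurable rectangles.\<close>
    have "B \<in> sigma_sets UNIV (range (\<lambda>t. {..t}))" using B unfolding borel_Iic .
    from Iic_stable subset_UNIV[of "range (\<lambda>t :: real. {..t})", folded Pow_UNIV] this show ?thesis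
    proof (induction rule: sigma_sets_induct_disjoint)
      case (basic C)
      then show ?case using P_Iic[OF A] by auto
    next
      case empty
      then show ?case using P_empty by simp
    next
      case (compl C)
      have "A \<times> (UNIV - C) = A \<times> UNIV - A \<times> C" by auto
      then show ?case using P_diff[OF P_UNIV[OF A] compl(2)] by auto
    next
      case (union C)
      have "disjoint_family (\<lambda>i. A \<times> C i)"
        using union(1) by (auto simp: disjoint_family_on_def)
      moreover have "A \<times> (\<Union>i. C i) = (\<Union>i. A \<times> C i)" by auto
      ultimately show ?case using P_UN[OF union(3)] by simp
    qed
  qed
  have P: "P H" if "H \<in> sets (borel \<Otimes>\<^sub>M borel)" for H
  proof -
    have "H \<in> sigma_sets (space borel \<times> space borel) {a \<times> b | a b. a \<in> sets borel \<and> b \<in> sets borel}"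
      using that unfolding sets_pair_measure .
    from Int_stable_pair_measure_generator pair_measure_closed this show ?thesis
    proof (induction rule: sigma_sets_induct_disjoint)
      case (basic C)
      then show ?case using P_rect by auto
    next
      case empty
      then show ?case using P_empty by simp
    next
      case (compl C)
      have "P (UNIV \<times> UNIV - C)"
        by (rule P_diff[OF P_UNIV compl(2)]) auto
      then show ?case by simp
    next
      case (union C)
      then show ?case by (intro P_UN)
    qed
  qed
  have "(\<lambda>u. emeasure (K u) B) \<in> borel_measurable borel" if "B \<in> sets borel" for B
    using P_rect[OF _ that, of UNIV] by (simp add: P_def vimage_def)
  with P show thesis
    by (intro that[of K] K sets_K) (simp_all add: P_def)
qed

section \<open>Atoms of conditional measures and measurable graphs\<close>

text \<open>Almost every conditional measure is carried by a countable section of \<open>G\<close>,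
  hence by its atoms. Each atom is the median of the conditional measure on some rational interval,
  and there are only countably many such intervals.\<close>

lemma measurable_graphs_covering_countable_sections:
  fixes L :: "(real \<times> real) measure"
  assumes "prob_space L" and L: "sets L = sets (borel \<Otimes>\<^sub>M borel)"
    and bounds: "AE z in L. 0 \<le> snd z \<and> snd z \<le> 1"
    and G: "G \<in> sets (borel \<Otimes>\<^sub>M borel)" and AE_G: "AE z in L. z \<in> G"
    and countable: "\<And>u. countable {v. (u, v) \<in> G}"
  obtains U :: "nat \<Rightarrow> (real \<times> real) set"
  where "\<And>n. U n \<in> sets (borel \<Otimes>\<^sub>M borel)"
    and "\<And>n u v v'. (u, v) \<in> U n \<Longrightarrow> (u, v') \<in> U n \<Longrightarrow> v = v'"
    and "AE z in L. z \<in> (\<Union>n. U n)"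
proof -
  interpret prob_space L by fact
  note [measurable_cong] = L
  have space: "space L = UNIV" using sets_eq_imp_space_eq[OF L] by (simp add: space_pair_measure)
  obtain K :: "real \<Rightarrow> real measure"
    where K: "\<And>u. prob_space (K u)" and sets_K[measurable_cong]: "\<And>u. sets (K u) = sets borel"
    and K_meas[measurable]: "\<And>B. B \<in> sets borel \<Longrightarrow> (\<lambda>u. emeasure (K u) B) \<in> borel_measurable borel"
    and K_int: "\<And>H. H \<in> sets (borel \<Otimes>\<^sub>M borel) \<Longrightarrow>
      (\<integral>\<^sup>+z. emeasure (K (fst z)) (Pair (fst z) -` H) \<partial>L) = emeasure L H"
    and K_slice[measurable]: "\<And>H. H \<in> sets (borel \<Otimes>\<^sub>M borel) \<Longrightarrow>
      (\<lambda>u. emeasure (K u) (Pair u -` H)) \<in> borel_measurable borel"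
    using disintegration[OF assms(1-3)] by blast
  have space_K: "space (K u) = UNIV" for u using sets_eq_imp_space_eq[OF sets_K[of u]] by simp
  have slice: "Pair u -` H \<in> sets (K u)" if "H \<in> sets (borel \<Otimes>\<^sub>M borel)" for u H
    using that unfolding sets_K by (rule sets_Pair1)
  \<comment> \<open>The missing mass of the slices is nonnegative and has integral
    \<open>1 - 1\<close>.\<close>
  have slice_1: "AE z in L. emeasure (K (fst z)) (Pair (fst z) -` H) = 1"
    if H: "H \<in> sets (borel \<Otimes>\<^sub>M borel)" and "emeasure L H = 1" for H
  proof -
    have le: "emeasure (K u) (Pair u -` H) \<le> 1" for u
      using prob_space.emeasure_le_1[OF K] .
    have [measurable]: "(\<lambda>z. emeasure (K (fst z)) (Pair (fst z) -` H)) \<in> borel_measurable L"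
      using K_slice[OF H] by measurable
    have "(\<integral>\<^sup>+z. 1 - emeasure (K (fst z)) (Pair (fst z) -` H) \<partial>L) = (\<integral>\<^sup>+z. 1 \<partial>L) - emeasure L H"
      by (subst nn_integral_diff) (simp_all add: K_int[OF H] le emeasure_eq_measure)
    also have "\<dots> = 0" using that(2) by (simp add: emeasure_space_1)
    finally have "AE z in L. 1 - emeasure (K (fst z)) (Pair (fst z) -` H) = 0"
      by (subst (asm) nn_integral_0_iff_AE) simp_all
    then show ?thesis
      by eventually_elim (use le in \<open>auto intro: antisym simp: diff_eq_0_iff_ennreal\<close>)
  qed
  \<comment> \<open>\<open>(u, v) \<in> U (a, b)\<close> says that \<open>v\<close> is the median of \<open>K u\<close> restricted to \<open>{a<..b}\<close>; the comparisons
    with all rationals \<open>q\<close> make it unique and the condition measurable.\<close>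
  define U :: "rat \<times> rat \<Rightarrow> (real \<times> real) set"
    where "U = (\<lambda>(a, b). {z. of_rat a < snd z \<and> snd z \<le> of_rat b \<and>
      (\<forall>q. a < q \<longrightarrow> q \<le> b \<longrightarrow> (snd z \<le> of_rat q \<longleftrightarrow>
        emeasure (K (fst z)) {of_rat a<..of_rat b} < 2 * emeasure (K (fst z)) {of_rat a<..of_rat q}))})"
  have U_sets: "U i \<in> sets (borel \<Otimes>\<^sub>M borel)" for i
  proof -
    obtain a b where i: "i = (a, b)" by (cases i)
    have "{z \<in> space (borel \<Otimes>\<^sub>M borel). of_rat a < snd z \<and> snd z \<le> of_rat b \<and>
      (\<forall>q. a < q \<longrightarrow> q \<le> b \<longrightarrow> (snd z \<le> of_rat q \<longleftrightarrow>
        emeasure (K (fst z)) {of_rat a<..of_rat b} < 2 * emeasure (K (fst z)) {of_rat a<..of_rat q}))}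
      \<in> sets (borel \<Otimes>\<^sub>M (borel :: real measure))"
      by measurable
    then show ?thesis by (simp add: U_def i space_pair_measure)
  qed
  have U_graph: "v = v'" if "(u, v) \<in> U i" "(u, v') \<in> U i" for u v v' i
  proof -
    obtain a b where i: "i = (a, b)" by (cases i)
    have *: False if less: "w < w'" and w: "(u, w) \<in> U i" and w': "(u, w') \<in> U i" for w w'
    proof -
      obtain q where q: "w < of_rat q" "of_rat q < w'" using of_rat_dense[OF less] by (elim exE conjE)
      have "of_rat a < w" "w' \<le> of_rat b" using w w' by (simp_all add: U_def i)
      with q have "of_rat a < (of_rat q :: real)" "of_rat q \<le> (of_rat b :: real)" by linarith+
      then have "a < q" "q \<le> b" by (simp_all add: of_rat_less of_rat_less_eq)
      with w w' have "w \<le> of_rat q \<longleftrightarrow> w' \<le> of_rat q" by (simp add: U_def i)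
      with q show False by linarith
    qed
    show ?thesis using *[of v v'] *[of v' v] that by (cases v v' rule: linorder_cases) simp_all
  qed
  have atom: "v \<in> Pair u -` (\<Union>i. U i)" if pos: "emeasure (K u) {v} \<noteq> 0" for u v
  proof -
    interpret K: prob_space "K u" by (rule K)
    define \<mu> where "\<mu> B = measure (K u) B" for B
    have \<mu>: "emeasure (K u) B = ennreal (\<mu> B)" for B by (simp add: \<mu>_def K.emeasure_eq_measure)
    have pos': "0 < \<mu> {v}" using pos \<mu>[of "{v}"] by (simp add: \<mu>_def zero_less_measure_iff)
    have "(\<lambda>n. \<mu> {v - 1 / real (Suc n)<..v + 1 / real (Suc n)}) \<longlonglongrightarrow> \<mu> (\<Inter>n. {v - 1 / real (Suc n)<..v + 1 / real (Suc n)})"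
      unfolding \<mu>_def
    proof (rule K.finite_Lim_measure_decseq)
      have *: "1 / real (Suc n) \<le> 1 / real (Suc m)" if "m \<le> n" for m n
        using that by (simp add: frac_le)
      show "decseq (\<lambda>n. {v - 1 / real (Suc n)<..v + 1 / real (Suc n)})"
      proof (intro antimonoI subsetI)
        fix m n w assume "m \<le> n" and w: "w \<in> {v - 1 / real (Suc n)<..v + 1 / real (Suc n)}"
        then show "w \<in> {v - 1 / real (Suc m)<..v + 1 / real (Suc m)}"
          using *[of m n] w unfolding greaterThanAtMost_iff by linarith
      qed
    qed auto
    moreover have "(\<Inter>n. {v - 1 / real (Suc n)<..v + 1 / real (Suc n)}) = {v}"
    proof (intro equalityI subsetI)
      fix w assume w: "w \<in> (\<Inter>n. {v - 1 / real (Suc n)<..v + 1 / real (Suc n)})"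
      show "w \<in> {v}"
      proof (rule ccontr)
        assume "w \<notin> {v}"
        then have "0 < \<bar>w - v\<bar>" by simp
        then obtain n where "inverse (real (Suc n)) < \<bar>w - v\<bar>" using reals_Archimedean by blast
        then have "1 / real (Suc n) < \<bar>w - v\<bar>" by (simp only: inverse_eq_divide)
        moreover have "w \<in> {v - 1 / real (Suc n)<..v + 1 / real (Suc n)}" using w by blast
        ultimately show False by (simp only: greaterThanAtMost_iff) linarith
      qed
    qed simp
    ultimately have "(\<lambda>n. \<mu> {v - 1 / real (Suc n)<..v + 1 / real (Suc n)}) \<longlonglongrightarrow> \<mu> {v}" by simp
    moreover have "\<mu> {v} < 2 * \<mu> {v}" using pos' by simp
    ultimately have "\<forall>\<^sub>F n in sequentially. \<mu> {v - 1 / real (Suc n)<..v + 1 / real (Suc n)} < 2 * \<mu> {v}"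
      by (rule order_tendstoD)
    then obtain n where n: "\<mu> {v - 1 / real (Suc n)<..v + 1 / real (Suc n)} < 2 * \<mu> {v}"
      by (auto simp: eventually_sequentially)
    have inv: "0 < 1 / real (Suc n)" by simp
    obtain a where a: "v - 1 / real (Suc n) < of_rat a" "of_rat a < v"
      using of_rat_dense[of "v - 1 / real (Suc n)" v] inv by auto
    obtain b where b: "v < of_rat b" "of_rat b < v + 1 / real (Suc n)"
      using of_rat_dense[of v "v + 1 / real (Suc n)"] inv by auto
    have "\<mu> {of_rat a<..of_rat b} \<le> \<mu> {v - 1 / real (Suc n)<..v + 1 / real (Suc n)}"
      unfolding \<mu>_def using a b by (intro K.finite_measure_mono) (auto simp: sets_K)
    \<comment> \<open>The point \<open>v\<close> now outweighs the rest of
      \<open>{of_rat a<..of_rat b}\<close>. Hence an initial part of this interval has more than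
      half of its mass exactly when it contains \<open>v\<close>.\<close>
    with n have half: "\<mu> {of_rat a<..of_rat b} < 2 * \<mu> {v}" by simp
    have "v \<le> of_rat q \<longleftrightarrow> \<mu> {of_rat a<..of_rat b} < 2 * \<mu> {of_rat a<..of_rat q}"
      if q: "of_rat a < (of_rat q :: real)" "of_rat q \<le> (of_rat b :: real)" for q
    proof
      assume "v \<le> of_rat q"
      then have "\<mu> {v} \<le> \<mu> {of_rat a<..of_rat q}"
        unfolding \<mu>_def using a by (intro K.finite_measure_mono) (auto simp: sets_K)
      with half show "\<mu> {of_rat a<..of_rat b} < 2 * \<mu> {of_rat a<..of_rat q}" by simp
    next
      assume less: "\<mu> {of_rat a<..of_rat b} < 2 * \<mu> {of_rat a<..of_rat q}"
      show "v \<le> of_rat q"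
      proof (rule ccontr)
        assume v: "\<not> v \<le> of_rat q"
        then have "\<mu> ({of_rat a<..of_rat q} \<union> {v}) = \<mu> {of_rat a<..of_rat q} + \<mu> {v}"
          unfolding \<mu>_def by (intro K.finite_measure_Union) (auto simp: sets_K)
        moreover have "\<mu> ({of_rat a<..of_rat q} \<union> {v}) \<le> \<mu> {of_rat a<..of_rat b}"
          unfolding \<mu>_def using a b q(2) by (intro K.finite_measure_mono) (auto simp: sets_K)
        ultimately show False using half less by linarith
      qed
    qed
    moreover have "emeasure (K u) {of_rat a<..of_rat b} < 2 * emeasure (K u) {of_rat a<..of_rat q}
        \<longleftrightarrow> \<mu> {of_rat a<..of_rat b} < 2 * \<mu> {of_rat a<..of_rat q}" for q
    proof -
      have "2 * ennreal (\<mu> B) = ennreal (2 * \<mu> B)" for B by (simp add: \<mu>_def ennreal_mult)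
      then show ?thesis by (simp add: \<mu> \<mu>_def ennreal_less_iff)
    qed
    ultimately have "(u, v) \<in> U (a, b)"
      using a(2) b(1) by (simp add: U_def of_rat_less of_rat_less_eq)
    then show ?thesis by blast
  qed
  define W where "W = (\<Union>i. U i)"
  have W: "W \<in> sets (borel \<Otimes>\<^sub>M borel)" unfolding W_def using U_sets by auto
  have "emeasure L G = 1"
    using AE_G G by (intro emeasure_eq_1_AE) (simp_all add: L)
  then have "AE z in L. emeasure (K (fst z)) (Pair (fst z) -` G) = 1" by (rule slice_1[OF G])
  then have "AE z in L. emeasure (K (fst z)) (Pair (fst z) -` W) = 1"
  proof eventually_elim
    case (elim z)
    define u where "u = fst z"
    interpret K: prob_space "K u" by (rule K)
    have W': "Pair u -` W \<in> sets (K u)" by (rule slice[OF W])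
    \<comment> \<open>What \<open>W\<close> misses of the slice of \<open>G\<close> is countable and
      contains no atom, so it has mass 0.\<close>
    have cnt: "countable (Pair u -` G - Pair u -` W)"
      using countable[of u] by (auto simp: vimage_def intro: countable_subset)
    have "emeasure (K u) (Pair u -` G - Pair u -` W)
        = (\<integral>\<^sup>+v. emeasure (K u) {v} \<partial>count_space (Pair u -` G - Pair u -` W))"
      by (rule emeasure_countable_singleton[OF _ cnt]) (simp add: sets_K)
    also have "\<dots> = (\<integral>\<^sup>+v. 0 \<partial>count_space (Pair u -` G - Pair u -` W))"
      using atom[of u] by (intro nn_integral_cong) (auto simp: W_def)
    finally have null: "emeasure (K u) (Pair u -` G - Pair u -` W) = 0" by simp
    have "1 \<le> emeasure (K u) (Pair u -` W \<union> (Pair u -` G - Pair u -` W))"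
      using elim slice[OF G, of u] W' emeasure_mono[of "Pair u -` G" "Pair u -` W \<union> (Pair u -` G - Pair u -` W)" "K u"]
      by (auto simp: u_def)
    also have "\<dots> \<le> emeasure (K u) (Pair u -` W) + emeasure (K u) (Pair u -` G - Pair u -` W)"
      using slice[OF G, of u] W' by (intro emeasure_subadditive) auto
    finally show ?case
      using null K.emeasure_le_1[of "Pair u -` W"] by (simp add: u_def)
  qed
  then have "(\<integral>\<^sup>+z. emeasure (K (fst z)) (Pair (fst z) -` W) \<partial>L) = (\<integral>\<^sup>+z. 1 \<partial>L)"
    by (rule nn_integral_cong_AE)
  then have "emeasure L W = 1" using K_int[OF W] by (simp add: emeasure_space_1)
  then have "AE z in L. z \<in> W"
    using W AE_iff_emeasure_eq_1[of "\<lambda>z. z \<in> W"] by (simp add: space)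
  moreover have "W = (\<Union>n. U (from_nat n))"
    unfolding W_def using surj_from_nat by (metis image_image)
  ultimately show thesis
    using U_sets U_graph by (intro that[of "\<lambda>n. U (from_nat n)"]) auto
qed

subsection \<open>Coding standard Borel spaces\<close>

text \<open>At the first index \<open>k\<close> where the sets differ the terms differ by
  \<open>(1/3) ^ k\<close>, while all later terms together contribute at most half of that. Base two
  would not separate finite from cofinite patterns.\<close>

lemma ternary_series_inj:
  fixes S T :: "nat set"
  assumes eq: "(\<Sum>n. indicator S n * (1/3) ^ n) = (\<Sum>n. indicator T n * (1/3 :: real) ^ n)"
  shows "S = T"
proof (rule ccontr)
  assume "S \<noteq> T"
  define a where "a n = (indicator S n - indicator T n :: real)" for n
  have a: "\<bar>a n\<bar> \<le> 1" for n by (simp add: a_def indicator_def)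
  have geo: "summable (\<lambda>n. (1/3 :: real) ^ n)" by (rule summable_geometric) simp
  have summable: "summable (\<lambda>n. indicator S n * (1/3 :: real) ^ n)" for S :: "nat set"
    by (rule summable_comparison_test'[OF geo]) (simp add: indicator_def)
  have "(\<lambda>n. a n * (1/3) ^ n) sums ((\<Sum>n. indicator S n * (1/3) ^ n) - (\<Sum>n. indicator T n * (1/3) ^ n))"
    unfolding a_def left_diff_distrib by (intro sums_diff summable_sums summable)
  then have sums: "(\<lambda>n. a n * (1/3) ^ n) sums 0" by (simp add: eq)
  define k where "k = (LEAST n. a n \<noteq> 0)"
  have "\<exists>n. a n \<noteq> 0" using \<open>S \<noteq> T\<close> by (auto simp: a_def indicator_def)
  then have k: "a k \<noteq> 0" unfolding k_def by (rule LeastI_ex)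
  then have k1: "\<bar>a k\<bar> = 1" by (auto simp: a_def indicator_def split: if_splits)
  have "a n = 0" if "n < k" for n using not_less_Least that unfolding k_def by blast
  then have "(\<Sum>n<Suc k. a n * (1/3) ^ n) = a k * (1/3) ^ k" by simp
  with sums_split_initial_segment[OF sums, of "Suc k"]
  have tail: "(\<lambda>n. a (n + Suc k) * (1/3) ^ (n + Suc k)) sums (- (a k * (1/3) ^ k))" by simp
  have "(\<lambda>n. (1/3) ^ n :: real) sums (3/2)" using geometric_sums[of "1/3 :: real"] by simp
  then have geo': "(\<lambda>n. (1/3) ^ n * (1/3) ^ Suc k :: real) sums (3/2 * (1/3) ^ Suc k)"
    by (rule sums_mult2)
  have le: "\<bar>a (n + Suc k) * (1/3) ^ (n + Suc k)\<bar> \<le> (1/3) ^ n * (1/3) ^ Suc k" for n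
    using a[of "n + Suc k"] by (simp add: abs_mult power_add mult_left_le_one_le)
  have "\<bar>- (a k * (1/3) ^ k)\<bar> \<le> 3/2 * (1/3) ^ Suc k"
    using norm_suminf_le[OF _ sums_summable[OF geo'], of "\<lambda>n. a (n + Suc k) * (1/3) ^ (n + Suc k)"] le
      sums_unique[OF tail] sums_unique[OF geo'] by simp
  then show False using k1 by (simp add: abs_mult)
qed

text \<open>In a Hausdorff space a point is determined by the members of a countable base that
  contain it; this pattern is written as a ternary expansion.\<close>

lemma standard_borel_embedding:
  fixes M :: "'a measure"
  assumes "standard_borel M"
  obtains h :: "'a \<Rightarrow> real"
  where "h \<in> M \<rightarrow>\<^sub>M borel" "inj_on h (space M)" "\<And>x. 0 \<le> h x" "\<And>x. h x \<le> 1"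
proof -
  obtain T where T: "completely_metrizable_space T" "second_countable T" "topspace T = space M"
    and sets: "sets M = sigma_sets (topspace T) {U. openin T U}"
    using assms unfolding standard_borel_def by blast
  have open_sets: "U \<in> sets M" if "openin T U" for U using that unfolding sets by auto
  obtain \<B> where \<B>': "countable \<B> \<and> (\<forall>V\<in>\<B>. openin T V)
      \<and> (\<forall>U x. openin T U \<and> x \<in> U \<longrightarrow> (\<exists>V\<in>\<B>. x \<in> V \<and> V \<subseteq> U))"
    using T(2) unfolding second_countable_def ..
  then have \<B>: "countable \<B>" "\<And>V. V \<in> \<B> \<Longrightarrow> openin T V" by simp_all
  have base: "\<exists>V\<in>\<B>. x \<in> V \<and> V \<subseteq> U" if "openin T U" "x \<in> U" for U x
    using \<B>' that by simp
  \<comment> \<open>The empty set is inserted so that the enumeration is total even for an empty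
    base.\<close>
  define B where "B = from_nat_into (insert {} \<B>)"
  have range_B: "range B = insert {} \<B>"
    unfolding B_def using \<B>(1) by (intro range_from_nat_into) auto
  have [measurable]: "B n \<in> sets M" for n
  proof -
    have "B n \<in> insert {} \<B>" unfolding range_B[symmetric] by simp
    then show ?thesis using \<B>(2) open_sets by auto
  qed
  \<comment> \<open>The series is at most \<open>3/2\<close>, so halving brings its values into
    \<open>[0, 1]\<close>.\<close>
  define h where "h x = (\<Sum>n. indicator {n. x \<in> B n} n * (1/3) ^ n) / (2 :: real)" for x
  have geo: "(\<lambda>n. (1/3) ^ n :: real) sums (3/2)" using geometric_sums[of "1/3 :: real"] by simp
  have le: "indicator {n. x \<in> B n} n * (1/3) ^ n \<le> (1/3 :: real) ^ n" for x n
    by (simp add: indicator_def)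
  have summable: "summable (\<lambda>n. indicator {n. x \<in> B n} n * (1/3 :: real) ^ n)" for x
    by (rule summable_comparison_test'[OF sums_summable[OF geo]]) (simp add: indicator_def)
  show thesis
  proof (rule that[of h])
    have "h = (\<lambda>x. (\<Sum>n. indicator (B n) x * (1/3) ^ n) / 2)"
      by (rule ext) (simp add: h_def indicator_def)
    then show "h \<in> M \<rightarrow>\<^sub>M borel" by simp
    show "0 \<le> h x" for x
      unfolding h_def by (intro divide_nonneg_nonneg suminf_nonneg summable) auto
    show "h x \<le> 1" for x
      using suminf_le[OF le summable sums_summable[OF geo], of x] sums_unique[OF geo]
      by (simp add: h_def)
    show "inj_on h (space M)"
    proof (rule inj_onI, rule ccontr)
      fix x y assume xy: "x \<in> space M" "y \<in> space M" "h x = h y" "x \<noteq> y"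
      have "{n. x \<in> B n} = {n. y \<in> B n}"
        using xy(3) by (intro ternary_series_inj) (simp add: h_def)
      then have same: "x \<in> V \<longleftrightarrow> y \<in> V" if "V \<in> \<B>" for V
      proof -
        have "V \<in> range B" using that unfolding range_B by simp
        then obtain n where "V = B n" by blast
        then show ?thesis using \<open>{n. x \<in> B n} = {n. y \<in> B n}\<close> by (simp add: set_eq_iff)
      qed
      have "Hausdorff_space T"
        by (intro metrizable_imp_Hausdorff_space completely_metrizable_imp_metrizable_space T(1))
      moreover have "x \<in> topspace T" "y \<in> topspace T" using xy T(3) by simp_all
      ultimately have "\<exists>U V. openin T U \<and> openin T V \<and> x \<in> U \<and> y \<in> V \<and> disjnt U V"
        using xy(4) unfolding Hausdorff_space_def by simp
      then obtain U where U: "openin T U" "x \<in> U" "y \<notin> U" by (auto simp: disjnt_iff)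
      obtain V where "V \<in> \<B>" "x \<in> V" "V \<subseteq> U" using base[OF U(1,2)] by (elim bexE conjE)
      with same[of V] U(3) show False by auto
    qed
  qed
qed

text \<open>A stream names a sequence in a countable dense set. Rapidly converging sequences reach
  every point, and their limits are measurable because each term locates the limit with a known
  error.\<close>

lemma standard_borel_parametrization:
  fixes M :: "'a measure"
  assumes "standard_borel M" and "space M \<noteq> {}"
  obtains p :: "(nat \<Rightarrow> nat) \<Rightarrow> 'a"
  where "p \<in> borel \<rightarrow>\<^sub>M M" "space M \<subseteq> range p"
proof -
  obtain T where T: "completely_metrizable_space T" "second_countable T" "topspace T = space M"
    and sets: "sets M = sigma_sets (topspace T) {U. openin T U}"
    using assms unfolding standard_borel_def by blast
  obtain X d where X: "Metric_space X d" "Metric_space.mcomplete X d" "T = Metric_space.mtopology X d"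
    using T(1) unfolding completely_metrizable_space_def by blast
  interpret Metric_space X d by fact
  have space: "X = space M" using T(3) X(3) by simp
  obtain C where C: "countable C" "C \<subseteq> X" "mtopology closure_of C = X"
    using second_countable_imp_separable_space[OF T(2)] unfolding separable_space_def X(3) by auto
  have "C \<noteq> {}" using C(3) assms(2) space by auto
  define c where "c = from_nat_into C"
  have c: "c i \<in> X" for i using C(2) from_nat_into[OF \<open>C \<noteq> {}\<close>] by (auto simp: c_def)
  have dense: "\<exists>i. d (c i) x < e" if x: "x \<in> X" and e: "0 < e" for x e
  proof -
    have "x \<in> mtopology closure_of C" using C(3) x by simp
    then obtain y where "y \<in> C" "y \<in> mball x e" using e unfolding metric_closure_of by blast
    moreover obtain i where "c i = y"
      using \<open>y \<in> C\<close> from_nat_into_surj[OF C(1)] unfolding c_def by blast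
    ultimately show ?thesis by (auto simp: commute intro!: exI[of _ i])
  qed
  \<comment> \<open>The sum of two errors is what the triangle inequality gives for terms within
    \<open>(1/2) ^ n\<close> of a common point, so every such approximating sequence belongs to
    \<open>W\<close>.\<close>
  define W where "W = {\<sigma> :: nat \<Rightarrow> nat. \<forall>n m. d (c (\<sigma> n)) (c (\<sigma> m)) \<le> (1/2) ^ n + (1/2) ^ m}"
  have half: "\<exists>n. (1/2) ^ n < e" if "0 < e" for e :: real
    using real_arch_pow_inv[OF that, of "1/2"] by auto
  have W: "\<exists>x\<in>X. \<forall>n. d (c (\<sigma> n)) x \<le> (1/2) ^ n" if \<sigma>: "\<sigma> \<in> W" for \<sigma>
  proof -
    have "MCauchy (\<lambda>n. c (\<sigma> n))"
      unfolding MCauchy_def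
    proof (intro conjI allI impI)
      fix e :: real assume "0 < e"
      then obtain N where N: "(1/2 :: real) ^ N < e / 2" using half[of "e / 2"] by auto
      have "d (c (\<sigma> n)) (c (\<sigma> m)) < e" if "N \<le> n" "N \<le> m" for n m
      proof -
        have "d (c (\<sigma> n)) (c (\<sigma> m)) \<le> (1/2) ^ n + (1/2) ^ m" using \<sigma> by (simp add: W_def)
        also have "\<dots> \<le> (1/2) ^ N + (1/2) ^ N" using that by (intro add_mono power_decreasing) auto
        finally show ?thesis using N by simp
      qed
      then show "\<exists>N. \<forall>n n'. N \<le> n \<longrightarrow> N \<le> n' \<longrightarrow> d (c (\<sigma> n)) (c (\<sigma> n')) < e" by blast
    qed (use c in auto)
    then obtain x where lim: "limitin mtopology (\<lambda>n. c (\<sigma> n)) x sequentially"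
      using X(2) unfolding mcomplete_def by blast
    then have x: "x \<in> X" using limitin_topspace by fastforce
    have "d (c (\<sigma> n)) x \<le> (1/2) ^ n" for n
    proof (rule field_le_epsilon)
      fix e :: real assume "0 < e"
      then obtain N where N: "\<And>m. N \<le> m \<Longrightarrow> d (c (\<sigma> m)) x < e / 2"
        using lim unfolding limit_metric_sequentially by (metis half_gt_zero)
      obtain m where m: "(1/2 :: real) ^ m < e / 2" using half[of "e / 2"] \<open>0 < e\<close> by auto
      have "d (c (\<sigma> n)) x \<le> d (c (\<sigma> n)) (c (\<sigma> (max m N))) + d (c (\<sigma> (max m N))) x"
        using c x by (intro triangle)
      moreover have "d (c (\<sigma> n)) (c (\<sigma> (max m N))) \<le> (1/2) ^ n + (1/2) ^ max m N"
        using \<sigma> by (simp add: W_def)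
      moreover have "(1/2 :: real) ^ max m N \<le> (1/2) ^ m" by (intro power_decreasing) auto
      ultimately show "d (c (\<sigma> n)) x \<le> (1/2) ^ n + e" using N[of "max m N"] m by linarith
    qed
    with x show ?thesis by blast
  qed
  define p where "p \<sigma> = (if \<sigma> \<in> W then SOME x. x \<in> X \<and> (\<forall>n. d (c (\<sigma> n)) x \<le> (1/2) ^ n) else c 0)" for \<sigma>
  have p: "p \<sigma> \<in> X" "d (c (\<sigma> n)) (p \<sigma>) \<le> (1/2) ^ n" if "\<sigma> \<in> W" for \<sigma> n
    using someI_ex[of "\<lambda>x. x \<in> X \<and> (\<forall>n. d (c (\<sigma> n)) x \<le> (1/2) ^ n)"] W[OF that] that
    by (auto simp: p_def)
  have coord[measurable]: "(\<lambda>\<sigma> :: nat \<Rightarrow> nat. \<sigma> n) \<in> borel \<rightarrow>\<^sub>M count_space UNIV" for n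
  proof (rule measurable_compose[OF measurable_product_coordinates[of n]])
    show "(\<lambda>i :: nat. i) \<in> borel \<rightarrow>\<^sub>M count_space UNIV"
      by (auto simp: measurable_def intro!: borel_open discrete_topology_class.open_discrete)
  qed
  have [measurable]: "W \<in> sets borel" unfolding W_def by measurable
  show thesis
  proof (rule that[of p])
    have "p \<in> borel \<rightarrow>\<^sub>M sigma (topspace T) {U. openin T U}"
    proof (rule measurable_measure_of)
      show "{U. openin T U} \<subseteq> Pow (topspace T)" by (auto dest: openin_subset)
      show "p \<in> space borel \<rightarrow> topspace T" using p c by (auto simp: T(3) space p_def)
      fix U assume "U \<in> {U. openin T U}"
      then have U: "openin mtopology U" by (simp add: X(3))
      \<comment> \<open>Membership of the limit in an open set is thereby a countable union of
        conditions on single coordinates.\<close>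
      have iff: "p \<sigma> \<in> U \<longleftrightarrow> (\<exists>n. mcball (c (\<sigma> n)) ((1/2) ^ n) \<subseteq> U)" if \<sigma>: "\<sigma> \<in> W" for \<sigma>
      proof
        assume "p \<sigma> \<in> U"
        then obtain e where e: "0 < e" "mball (p \<sigma>) e \<subseteq> U" using U unfolding openin_mtopology by blast
        obtain n where n: "(1/2 :: real) ^ n < e / 2" using half[of "e / 2"] e(1) by auto
        have "mcball (c (\<sigma> n)) ((1/2) ^ n) \<subseteq> mball (p \<sigma>) e"
        proof
          fix y assume "y \<in> mcball (c (\<sigma> n)) ((1/2) ^ n)"
          then have y: "y \<in> X" "d (c (\<sigma> n)) y \<le> (1/2) ^ n" by auto
          have "d (p \<sigma>) y \<le> d (p \<sigma>) (c (\<sigma> n)) + d (c (\<sigma> n)) y"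
            using p[OF \<sigma>] c y by (intro triangle)
          also have "\<dots> < e" using p(2)[OF \<sigma>, of n] y(2) n by (simp add: commute)
          finally show "y \<in> mball (p \<sigma>) e" using y(1) p(1)[OF \<sigma>] by simp
        qed
        with e(2) show "\<exists>n. mcball (c (\<sigma> n)) ((1/2) ^ n) \<subseteq> U" by blast
      next
        assume "\<exists>n. mcball (c (\<sigma> n)) ((1/2) ^ n) \<subseteq> U"
        then show "p \<sigma> \<in> U" using p[OF \<sigma>] c by auto
      qed
      have "p \<sigma> \<in> U \<longleftrightarrow> (\<sigma> \<in> W \<and> (\<exists>n. mcball (c (\<sigma> n)) ((1/2) ^ n) \<subseteq> U)) \<or> (\<sigma> \<notin> W \<and> c 0 \<in> U)" for \<sigma>
      proof (cases "\<sigma> \<in> W")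
        case False
        then show ?thesis by (simp add: p_def)
      qed (simp add: iff)
      then have "p -` U \<inter> space borel = {\<sigma> \<in> space borel. (\<sigma> \<in> W \<and> (\<exists>n. mcball (c (\<sigma> n)) ((1/2) ^ n) \<subseteq> U))
          \<or> (\<sigma> \<notin> W \<and> c 0 \<in> U)}"
        by (simp add: vimage_def)
      also have "\<dots> \<in> sets borel"
      proof -
        have [measurable]: "Measurable.pred borel (\<lambda>\<sigma>. mcball (c (\<sigma> n)) ((1/2) ^ n) \<subseteq> U)" for n
          by (rule measurable_compose[OF coord[of n]]) simp
        show ?thesis by measurable
      qed
      finally show "p -` U \<inter> space borel \<in> sets borel" .
    qed
    moreover have "sets (sigma (topspace T) {U. openin T U}) = sets M"
      unfolding sets by (rule sets_measure_of) (auto dest: openin_subset)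
    ultimately show "p \<in> borel \<rightarrow>\<^sub>M M" by (simp cong: measurable_cong_sets)
    show "space M \<subseteq> range p"
    proof
      fix x assume "x \<in> space M"
      then have x: "x \<in> X" by (simp add: space)
      have "\<forall>n. \<exists>i. d (c i) x < (1/2) ^ n" using dense[OF x] by simp
      from choice[OF this] obtain \<sigma> where \<sigma>: "\<forall>n. d (c (\<sigma> n)) x < (1/2) ^ n" ..
      have "d (c (\<sigma> n)) (c (\<sigma> m)) \<le> (1/2) ^ n + (1/2) ^ m" for n m
      proof -
        have "d (c (\<sigma> n)) (c (\<sigma> m)) \<le> d (c (\<sigma> n)) x + d x (c (\<sigma> m))" using c x by (intro triangle)
        then show ?thesis using \<sigma>[rule_format, of n] \<sigma>[rule_format, of m] by (simp add: commute)
      qed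
      then have W\<sigma>: "\<sigma> \<in> W" by (simp add: W_def)
      have "d (p \<sigma>) x \<le> 0"
      proof (rule field_le_epsilon)
        fix e :: real assume "0 < e"
        then obtain n where n: "(1/2 :: real) ^ n < e / 2" using half[of "e / 2"] by auto
        have "d (p \<sigma>) x \<le> d (p \<sigma>) (c (\<sigma> n)) + d (c (\<sigma> n)) x" using p[OF W\<sigma>] c x by (intro triangle)
        then show "d (p \<sigma>) x \<le> 0 + e"
          using p(2)[OF W\<sigma>, of n] \<sigma>[rule_format, of n] n by (simp add: commute)
      qed
      then have "p \<sigma> = x" using p(1)[OF W\<sigma>] x nonneg[of "p \<sigma>" x] zero[of "p \<sigma>" x] by simp
      then show "x \<in> range p" by blast
    qed
  qed
qed

subsection \<open>Fibre sums\<close>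

context coded_mp_equiv
begin

lemma R_equiv: "equiv (space M) R"
  using mp_equiv unfolding countable_mp_equiv_def by blast

lemma countable_class: "countable {y \<in> space M. (x, y) \<in> R}" if "x \<in> space M"
  using mp_equiv that unfolding countable_mp_equiv_def by blast

context
  fixes D :: "'a set" and \<tau> :: "'a \<Rightarrow> 'a"
  assumes D[measurable]: "D \<in> sets M" and \<tau>[measurable]: "\<tau> \<in> M \<rightarrow>\<^sub>M M"
    and graph: "\<And>x. x \<in> D \<Longrightarrow> (x, \<tau> x) \<in> R"
begin

section \<open>Images and injective pieces of the map\<close>

text \<open>Up to a null set the image of \<open>E\<close> is a set \<open>Q\<close> with a
  measurable section into \<open>E\<close>. The section identifies \<open>Q\<close> with a subset of
  the null set \<open>E\<close> inside \<open>R\<close>, so \<open>Q\<close> is null too.\<close>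

lemma null_image:
  assumes E: "E \<in> null_sets M" and "E \<subseteq> D"
  shows "\<exists>N\<in>null_sets M. \<tau> ` E \<subseteq> N"
proof -
  have E_sets[measurable]: "E \<in> sets M" by (rule null_setsD2[OF E])
  from selection[OF finite_measure_axioms refl E_sets \<tau>]
  obtain Q s N where Q[measurable]: "Q \<in> sets M" and s[measurable]: "s \<in> M \<rightarrow>\<^sub>M M"
      and N: "N \<in> null_sets M" and sel: "\<forall>y\<in>Q. s y \<in> E \<and> \<tau> (s y) = y"
      and cover: "\<tau> ` E \<subseteq> Q \<union> N"
    by (elim bexE conjE)
  \<comment> \<open>This is the range of the section over \<open>Q\<close>; comparing codes under
    \<open>h\<close> expresses \<open>s (\<tau> x) = x\<close> measurably.\<close>
  define A where "A = {x \<in> space M. x \<in> E \<and> \<tau> x \<in> Q \<and> h (s (\<tau> x)) = h x}"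
  have A[measurable]: "A \<in> sets M" unfolding A_def by measurable
  have "emeasure M A = emeasure M Q"
  proof (rule emeasure_iso[OF A Q \<tau> s])
    fix x assume "x \<in> A"
    then have x: "x \<in> space M" "x \<in> E" "\<tau> x \<in> Q" "h (s (\<tau> x)) = h x" by (simp_all add: A_def)
    moreover have "s (\<tau> x) \<in> space M" using measurable_space[OF s] measurable_space[OF \<tau>] x(1) by simp
    ultimately show "\<tau> x \<in> Q \<and> s (\<tau> x) = x \<and> (x, \<tau> x) \<in> R"
      using h_eq_iff graph subsetD[OF \<open>E \<subseteq> D\<close>] by simp
  next
    fix y assume y: "y \<in> Q"
    then have "s y \<in> E" "\<tau> (s y) = y" using sel by simp_all
    moreover have "s y \<in> space M" using \<open>s y \<in> E\<close> sets.sets_into_space[OF E_sets] by (rule rev_subsetD)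
    ultimately show "s y \<in> A \<and> \<tau> (s y) = y" using y by (simp add: A_def)
  qed
  moreover have "emeasure M A = 0"
    by (rule emeasure_eq_0[OF E_sets null_setsD1[OF E]]) (simp add: A_def subset_iff)
  ultimately have "Q \<in> null_sets M" using Q by (simp add: null_setsI)
  with N cover show ?thesis by (intro bexI[of _ "Q \<union> N"] null_sets.Un)
qed

text \<open>On an injective piece the selection inverts \<tau>, and invariance of the measure under
  this partial isomorphism becomes a change of variables.\<close>

lemma injective_image:
  assumes E[measurable]: "E \<in> sets M" and "E \<subseteq> D" and inj: "inj_on \<tau> E"
  shows "\<exists>Q\<in>sets M. \<exists>s \<in> M \<rightarrow>\<^sub>M M. \<exists>N\<in>null_sets M.
    (\<forall>y\<in>Q. s y \<in> E \<and> \<tau> (s y) = y) \<and> \<tau> ` E \<subseteq> Q \<union> N \<and>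
    (\<forall>f :: 'a \<Rightarrow> ennreal. f \<in> borel_measurable M \<longrightarrow>
      (\<integral>\<^sup>+x. indicator E x * f x \<partial>M) = (\<integral>\<^sup>+y. indicator Q y * f (s y) \<partial>M))"
proof -
  \<comment> \<open>Selecting relative to the image measure makes the discarded part of the domain
    null; \<open>null_image\<close> then makes its image null as well.\<close>
  define \<rho> where "\<rho> = distr (restrict_space M E) M \<tau>"
  have sub: "E \<subseteq> space M" by (rule sets.sets_into_space[OF E])
  have \<tau>E: "\<tau> \<in> restrict_space M E \<rightarrow>\<^sub>M M" by (rule measurable_restrict_space1[OF \<tau>])
  have "finite_measure (restrict_space M E)"
    by (rule finite_measure_restrict_space[OF finite_measure_axioms]) measurable
  then have "finite_measure \<rho>"
    unfolding \<rho>_def by (rule finite_measure.finite_measure_distr[OF _ \<tau>E])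
  moreover have "sets \<rho> = sets M" by (simp add: \<rho>_def)
  ultimately have "\<exists>Q\<in>sets M. \<exists>s \<in> M \<rightarrow>\<^sub>M M. \<exists>N\<in>null_sets \<rho>.
      (\<forall>y\<in>Q. s y \<in> E \<and> \<tau> (s y) = y) \<and> \<tau> ` E \<subseteq> Q \<union> N"
    by (rule selection[OF _ _ E \<tau>])
  then obtain Q s N where Q[measurable]: "Q \<in> sets M" and s[measurable]: "s \<in> M \<rightarrow>\<^sub>M M"
      and N: "N \<in> null_sets \<rho>" and sel: "\<forall>y\<in>Q. s y \<in> E \<and> \<tau> (s y) = y"
      and cover: "\<tau> ` E \<subseteq> Q \<union> N"
    by (elim bexE conjE)
  define A where "A = {x \<in> space M. x \<in> E \<and> \<tau> x \<in> Q}"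
  have A[measurable]: "A \<in> sets M" unfolding A_def by measurable
  have "\<tau> -` N \<inter> E \<in> null_sets (restrict_space M E)"
    using N null_sets_distr_iff[OF \<tau>E] sub by (simp add: \<rho>_def space_restrict_space Int_absorb2 Int_commute)
  then have "\<tau> -` N \<inter> E \<in> null_sets M"
    using null_sets_restrict_space[OF E] by simp
  moreover have "E - A \<subseteq> \<tau> -` N \<inter> E" using cover sub by (auto simp: A_def)
  ultimately have null: "E - A \<in> null_sets M" using E A by (auto intro: null_sets_subset)
  then obtain N' where N': "N' \<in> null_sets M" "\<tau> ` (E - A) \<subseteq> N'"
    using null_image[of "E - A"] \<open>E \<subseteq> D\<close> by auto
  have cover': "\<tau> ` E \<subseteq> Q \<union> N'" using N'(2) sub by (auto simp: A_def)
  have s\<tau>: "s (\<tau> x) = x" if "x \<in> A" for x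
    using that sel inj by (auto simp: A_def dest: inj_onD)
  have Q_vimage: "Q \<inter> s -` C \<in> sets M" if C[measurable]: "C \<in> sets M" for C
  proof -
    have "Q \<inter> s -` C = {y \<in> space M. y \<in> Q \<and> s y \<in> C}"
      using sets.sets_into_space[OF Q] by auto
    also have "\<dots> \<in> sets M" by measurable
    finally show ?thesis .
  qed
  have iso: "emeasure M (A \<inter> C) = emeasure M (Q \<inter> s -` C)" if C: "C \<in> sets M" for C
    using sel s\<tau> graph \<open>E \<subseteq> D\<close> sub
    by (intro emeasure_iso[of _ _ \<tau> s] Q_vimage \<tau> s sets.Int A C) (auto simp: A_def)
  have s_Q: "s \<in> density M (indicator Q) \<rightarrow>\<^sub>M M" by simp
  \<comment> \<open>The section carries \<open>M\<close> restricted to \<open>Q\<close> to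
    \<open>M\<close> restricted to \<open>A\<close>; as an equality of measures this applies to all
    integrands.\<close>
  have density: "distr (density M (indicator Q)) M s = density M (indicator A)"
  proof (rule measure_eqI)
    fix C assume "C \<in> sets (distr (density M (indicator Q)) M s)"
    then have C[measurable]: "C \<in> sets M" by simp
    have "emeasure (distr (density M (indicator Q)) M s) C = emeasure (density M (indicator Q)) (s -` C \<inter> space M)"
      by (simp add: emeasure_distr[OF s_Q C])
    also have "\<dots> = (\<integral>\<^sup>+y. indicator Q y * indicator (s -` C \<inter> space M) y \<partial>M)"
      by (rule emeasure_density) measurable
    also have "\<dots> = (\<integral>\<^sup>+y. indicator (Q \<inter> s -` C) y \<partial>M)"
      by (intro nn_integral_cong) (auto simp: indicator_def)
    also have "\<dots> = emeasure M (Q \<inter> s -` C)" by (rule nn_integral_indicator[OF Q_vimage[OF C]])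
    also have "\<dots> = emeasure M (A \<inter> C)" by (rule iso[OF C, symmetric])
    also have "\<dots> = (\<integral>\<^sup>+y. indicator (A \<inter> C) y \<partial>M)"
      by (rule nn_integral_indicator[symmetric]) measurable
    also have "\<dots> = (\<integral>\<^sup>+y. indicator A y * indicator C y \<partial>M)"
      by (intro nn_integral_cong) (rule indicator_inter_arith)
    also have "\<dots> = emeasure (density M (indicator A)) C"
      by (rule emeasure_density[symmetric]) measurable
    finally show "emeasure (distr (density M (indicator Q)) M s) C = emeasure (density M (indicator A)) C" .
  qed simp
  have "(\<integral>\<^sup>+x. indicator E x * f x \<partial>M) = (\<integral>\<^sup>+y. indicator Q y * f (s y) \<partial>M)"
    if f[measurable]: "f \<in> borel_measurable M" for f :: "'a \<Rightarrow> ennreal"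
  proof -
    have "AE x in M. x \<notin> E - A" using null by (rule AE_not_in)
    then have "(\<integral>\<^sup>+x. indicator E x * f x \<partial>M) = (\<integral>\<^sup>+x. indicator A x * f x \<partial>M)"
      by (intro nn_integral_cong_AE, eventually_elim) (auto simp: A_def indicator_def)
    also have "\<dots> = (\<integral>\<^sup>+x. f x \<partial>density M (indicator A))"
      by (rule nn_integral_density[symmetric]) simp_all
    also have "\<dots> = (\<integral>\<^sup>+y. f (s y) \<partial>density M (indicator Q))"
      unfolding density[symmetric] by (rule nn_integral_distr[OF s_Q]) simp
    also have "\<dots> = (\<integral>\<^sup>+y. indicator Q y * f (s y) \<partial>M)"
      by (rule nn_integral_density) simp_all
    finally show ?thesis .
  qed
  with Q s N'(1) sel cover' show ?thesis
    by (intro bexI[of _ Q] bexI[of _ s] bexI[of _ N'] conjI) simp_all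
qed

text \<open>The joint law of the codes of \<tau> \<open>x\<close> and \<open>x\<close> is
  concentrated on a set with countable sections. The graphs covering it almost everywhere pull back
  to pieces on which \<tau> \<open>x\<close> determines \<open>x\<close>.\<close>

lemma injective_partition:
  assumes AE_D: "AE x in M. x \<in> D"
  shows "\<exists>B :: nat \<Rightarrow> 'a set. (\<forall>n. B n \<in> sets M \<and> B n \<subseteq> D \<and> inj_on \<tau> (B n)) \<and>
    disjoint_family B \<and> D - (\<Union>n. B n) \<in> null_sets M"
proof -
  have D_sub: "D \<subseteq> space M" by (rule sets.sets_into_space[OF D])
  have "finite_measure (distr M borel h)" by (rule finite_measure_distr) simp
  from selection_real[OF this sets_distr D h_measurable]
  obtain Q k N where Q[measurable]: "Q \<in> sets borel" and k[measurable]: "k \<in> borel \<rightarrow>\<^sub>M M"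
      and N: "N \<in> null_sets (distr M borel h)" and kQ: "\<forall>t\<in>Q. k t \<in> D \<and> h (k t) = t"
      and cover: "h ` D \<subseteq> Q \<union> N"
    by (elim bexE conjE)
  define pair where "pair x = (h (\<tau> x), h x)" for x
  have pair[measurable]: "pair \<in> M \<rightarrow>\<^sub>M borel \<Otimes>\<^sub>M borel" unfolding pair_def by measurable
  define L where "L = distr M (borel \<Otimes>\<^sub>M borel) pair"
  have L: "prob_space L" unfolding L_def by (rule prob_space_distr[OF pair])
  \<comment> \<open>The section \<open>k\<close> inverts \<open>h\<close> at almost every point of
    \<open>D\<close>, which lets the pairs of codes be described by a Borel condition.\<close>
  define G where "G = {z :: real \<times> real. snd z \<in> Q \<and> h (\<tau> (k (snd z))) = fst z}"
  have "{z \<in> space (borel \<Otimes>\<^sub>M borel). snd z \<in> Q \<and> h (\<tau> (k (snd z))) = fst z} \<in> sets (borel \<Otimes>\<^sub>M borel)"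
    by measurable
  then have G[measurable]: "G \<in> sets (borel \<Otimes>\<^sub>M borel)" by (simp add: G_def space_pair_measure)
  have "AE x in M. h x \<notin> N"
    by (rule AE_distrD[OF h_measurable AE_not_in[OF N]])
  with AE_D have AE_G: "AE x in M. pair x \<in> G"
  proof eventually_elim
    case (elim x)
    then have hx: "h x \<in> Q" using cover by blast
    then have "k (h x) = x" using kQ elim D_sub h_eq_iff[of "k (h x)" x] by blast
    with hx show ?case by (simp add: G_def pair_def)
  qed
  \<comment> \<open>A nonempty section codes points that \<tau> sends to one common
    \<open>y\<close>; they all lie in the class of \<open>y\<close>.\<close>
  have "countable {v. (u, v) \<in> G}" for u
  proof (cases "{v. (u, v) \<in> G} = {}")
    case False
    then obtain v\<^sub>0 where v0: "v\<^sub>0 \<in> Q" "h (\<tau> (k v\<^sub>0)) = u" by (auto simp: G_def)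
    define y where "y = \<tau> (k v\<^sub>0)"
    have y: "y \<in> space M" using measurable_space[OF \<tau>] kQ v0 D_sub unfolding y_def by blast
    have "v \<in> h ` {x \<in> space M. (y, x) \<in> R}" if v: "v \<in> Q" "h (\<tau> (k v)) = u" for v
    proof -
      have kv: "k v \<in> D" "h (k v) = v" using kQ v by blast+
      then have "\<tau> (k v) \<in> space M" using measurable_space[OF \<tau>] D_sub by blast
      then have "\<tau> (k v) = y" using h_eq_iff[OF _ y] v v0 by (simp add: y_def)
      with graph[OF kv(1)] have "(k v, y) \<in> R" by simp
      then have "(y, k v) \<in> R" using R_equiv by (auto simp: equiv_def dest: symD)
      with kv D_sub show ?thesis by (intro image_eqI[of _ _ "k v"]) auto
    qed
    then have "{v. (u, v) \<in> G} \<subseteq> h ` {x \<in> space M. (y, x) \<in> R}" by (auto simp: G_def)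
    then show ?thesis by (rule countable_subset) (intro countable_image countable_class[OF y])
  qed simp
  moreover have "AE z in L. z \<in> G" unfolding L_def using AE_G by (simp add: AE_distr_iff)
  moreover have "AE z in L. 0 \<le> snd z \<and> snd z \<le> 1"
    unfolding L_def by (subst AE_distr_iff) (simp_all add: pair_def h_bounds)
  ultimately obtain U :: "nat \<Rightarrow> (real \<times> real) set"
    where U[measurable]: "\<And>n. U n \<in> sets (borel \<Otimes>\<^sub>M borel)"
    and U_graph: "\<And>n u v v'. (u, v) \<in> U n \<Longrightarrow> (u, v') \<in> U n \<Longrightarrow> v = v'"
    and U_cover: "AE z in L. z \<in> (\<Union>n. U n)"
    using measurable_graphs_covering_countable_sections[OF L _ _ G] by (simp add: L_def) metis
  define B where "B n = {x \<in> space M. x \<in> D \<and> pair x \<in> U n}" for n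
  have B: "range B \<subseteq> sets M" unfolding B_def by auto
  have inj: "inj_on \<tau> (B n)" for n
  proof (rule inj_onI)
    fix x x' assume "x \<in> B n" "x' \<in> B n" "\<tau> x = \<tau> x'"
    then have "h x = h x'" "x \<in> space M" "x' \<in> space M"
      using U_graph[of "h (\<tau> x)" "h x" n "h x'"] by (simp_all add: B_def pair_def)
    then show "x = x'" by (simp add: h_eq_iff)
  qed
  have "AE x in M. pair x \<in> (\<Union>n. U n)"
    by (rule AE_distrD[OF pair U_cover[unfolded L_def]])
  then have "AE x in M. x \<notin> D - (\<Union>n. B n)"
    by eventually_elim (use D_sub in \<open>auto simp: B_def\<close>)
  moreover have "D - (\<Union>n. B n) \<in> sets M" using B by auto
  ultimately have null: "D - (\<Union>n. B n) \<in> null_sets M" by (simp add: AE_iff_null_sets)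
  show ?thesis
  proof (intro exI[of _ "disjointed B"] conjI allI)
    show "disjointed B n \<in> sets M" for n using sets.range_disjointed_sets[OF B] by auto
    show "disjointed B n \<subseteq> D" for n using disjointed_subset[of B n] by (auto simp: B_def)
    show "inj_on \<tau> (disjointed B n)" for n by (rule inj_on_subset[OF inj disjointed_subset])
    show "disjoint_family (disjointed B)" by (rule disjoint_family_disjointed)
    show "D - (\<Union>n. disjointed B n) \<in> null_sets M" using null by (simp only: UN_disjointed_eq)
  qed
qed

text \<open>For almost every \<open>y\<close> the fibre has exactly one point \<open>s n y\<close>
  in each piece with \<open>y\<close> in \<open>Q n\<close>, and no others. The fibre sum thus
  becomes a series that can be integrated term by term.\<close>

lemma fibre_sum_AE_eq:
  assumes AE_D: "AE x in M. x \<in> D" and f[measurable]: "f \<in> borel_measurable M"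
  obtains g where "g \<in> borel_measurable M" "AE y in M. fibre_sum D \<tau> f y = g y"
    "(\<integral>\<^sup>+x. f x \<partial>M) = (\<integral>\<^sup>+y. g y \<partial>M)"
proof -
  from injective_partition[OF AE_D] obtain B :: "nat \<Rightarrow> 'a set"
    where "\<forall>n. B n \<in> sets M \<and> B n \<subseteq> D \<and> inj_on \<tau> (B n)" and disj: "disjoint_family B"
    and null: "D - (\<Union>n. B n) \<in> null_sets M"
    by (elim exE conjE)
  then have B[measurable]: "B n \<in> sets M" and B_sub: "B n \<subseteq> D" and inj: "inj_on \<tau> (B n)" for n
    by simp_all
  define P where "P n Q s N \<longleftrightarrow> Q \<in> sets M \<and> s \<in> M \<rightarrow>\<^sub>M M \<and> N \<in> null_sets M \<and>
    (\<forall>y\<in>Q. s y \<in> B n \<and> \<tau> (s y) = y) \<and> \<tau> ` B n \<subseteq> Q \<union> N \<and>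
    (\<integral>\<^sup>+x. indicator (B n) x * f x \<partial>M) = (\<integral>\<^sup>+y. indicator Q y * f (s y) \<partial>M)" for n Q s N
  have "\<exists>Q s N. P n Q s N" for n
    using injective_image[OF B B_sub inj, of n] unfolding P_def
    by (elim bexE conjE, intro exI conjI) (assumption | simp)+
  then obtain Q s N where "P n (Q n) (s n) (N n)" for n by metis
  then have Q[measurable]: "\<And>n. Q n \<in> sets M"
    and s[measurable]: "\<And>n. s n \<in> M \<rightarrow>\<^sub>M M" and N: "\<And>n. N n \<in> null_sets M"
    and sel: "\<And>n y. y \<in> Q n \<Longrightarrow> s n y \<in> B n" "\<And>n y. y \<in> Q n \<Longrightarrow> \<tau> (s n y) = y"
    and cover: "\<And>n. \<tau> ` B n \<subseteq> Q n \<union> N n"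
    and int: "\<And>n. (\<integral>\<^sup>+x. indicator (B n) x * f x \<partial>M) = (\<integral>\<^sup>+y. indicator (Q n) y * f (s n y) \<partial>M)"
    unfolding P_def by simp_all
  obtain N' where N': "N' \<in> null_sets M" "\<tau> ` (D - (\<Union>n. B n)) \<subseteq> N'"
    using null_image[OF null Diff_subset] by (elim bexE)
  define g where "g y = (\<Sum>n. indicator (Q n) y * f (s n y))" for y
  \<comment> \<open>Outside these null sets the fibre lies in the union of the pieces, and a fibre
    point in \<open>B n\<close> forces \<open>y\<close> into \<open>Q n\<close>.\<close>
  have "AE y in M. y \<notin> N' \<union> (\<Union>n. N n)"
    using N N'(1) by (intro AE_not_in null_sets.Un null_sets_UN)
  then have "AE y in M. fibre_sum D \<tau> f y = g y"
  proof eventually_elim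
    case (elim y)
    define I where "I = {n. y \<in> Q n}"
    have fibre: "\<tau> -` {y} \<inter> D = (\<lambda>n. s n y) ` I"
    proof (intro equalityI subsetI)
      fix x assume x: "x \<in> \<tau> -` {y} \<inter> D"
      then obtain n where n: "x \<in> B n" using N'(2) elim by blast
      then have "y \<in> Q n" using x cover[of n] elim by blast
      moreover have "s n y = x"
        using inj_onD[OF inj[of n], of "s n y" x] sel[OF \<open>y \<in> Q n\<close>] x n by simp
      ultimately show "x \<in> (\<lambda>n. s n y) ` I" unfolding I_def by blast
    next
      fix x assume "x \<in> (\<lambda>n. s n y) ` I"
      then show "x \<in> \<tau> -` {y} \<inter> D" using sel B_sub unfolding I_def by blast
    qed
    have inj_I: "inj_on (\<lambda>n. s n y) I"
    proof (rule inj_onI)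
      fix m n assume "m \<in> I" "n \<in> I" "s m y = s n y"
      then have "s n y \<in> B m \<inter> B n" using sel(1)[of y m] sel(1)[of y n] by (simp add: I_def)
      then show "m = n" using disj by (auto simp: disjoint_family_on_def)
    qed
    have "fibre_sum D \<tau> f y = (\<Sum>\<^sub>\<infinity>n\<in>I. f (s n y))"
      unfolding fibre_sum_def fibre by (simp add: infsum_reindex[OF inj_I] comp_def)
    also have "\<dots> = (\<Sum>\<^sub>\<infinity>n. indicator (Q n) y * f (s n y))"
      by (rule infsum_cong_neutral) (auto simp: I_def)
    also have "\<dots> = g y"
      unfolding g_def
      by (rule sums_unique, rule has_sum_imp_sums, rule has_sum_infsum, rule nonneg_summable_on_complete) simp
    finally show ?case .
  qed
  moreover have "g \<in> borel_measurable M" unfolding g_def by measurable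
  moreover have "(\<integral>\<^sup>+x. f x \<partial>M) = (\<integral>\<^sup>+y. g y \<partial>M)"
  proof -
    have "AE x in M. x \<notin> D - (\<Union>n. B n)" using null by (rule AE_not_in)
    with AE_D have "AE x in M. f x = (\<Sum>n. indicator (B n) x * f x)"
    proof eventually_elim
      case (elim x)
      have "(\<Sum>n. indicator (B n) x * f x) = (\<Sum>n. indicator (B n) x) * f x" by simp
      also have "(\<Sum>n. indicator (B n) x :: ennreal) = indicator (\<Union>n. B n) x"
        by (rule suminf_indicator[OF disj])
      finally show ?case using elim by simp
    qed
    then have "(\<integral>\<^sup>+x. f x \<partial>M) = (\<integral>\<^sup>+x. (\<Sum>n. indicator (B n) x * f x) \<partial>M)"
      by (rule nn_integral_cong_AE)
    also have "\<dots> = (\<Sum>n. \<integral>\<^sup>+x. indicator (B n) x * f x \<partial>M)"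
      by (rule nn_integral_suminf) measurable
    also have "\<dots> = (\<integral>\<^sup>+y. g y \<partial>M)"
      unfolding int g_def by (rule nn_integral_suminf[symmetric]) measurable
    finally show ?thesis .
  qed
  ultimately show thesis using that by blast
qed

end

end

section \<open>Measurability in the completion, fibre cardinalities and the theorem\<close>

text \<open>The fibre sum is compared with a measurable function only off a null set, so its
  measurability is obtained for the completion.\<close>

lemma measurable_completion_AE:
  assumes g: "g \<in> M \<rightarrow>\<^sub>M N" and f: "f \<in> space M \<rightarrow> space N" and eq: "AE x in M. f x = g x"
  shows "f \<in> completion M \<rightarrow>\<^sub>M N"
proof (rule measurableI)
  fix S assume S: "S \<in> sets N"
  have "AE x in completion M. x \<in> g -` S \<inter> space M \<longleftrightarrow> x \<in> f -` S \<inter> space M"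
    using AE_completion[OF eq] by eventually_elim simp
  moreover have "g -` S \<inter> space M \<in> sets (completion M)"
    using measurable_sets[OF g S] by simp
  ultimately show "f -` S \<inter> space (completion M) \<in> sets (completion M)"
    unfolding space_completion by (rule completion.in_sets_AE) simp
qed (use f in auto)

text \<open>On an infinite fibre, finite subsets of every size push the sum above each natural
  number, in agreement with counting measure.\<close>

lemma fibre_card_eq_fibre_sum: "fibre_card D \<tau> x = fibre_sum D \<tau> (\<lambda>_. 1) x"
proof (cases "finite (\<tau> -` {x} \<inter> D)")
  case True
  then show ?thesis by (simp add: fibre_card_def fibre_sum_def)
next
  case False
  let ?A = "\<tau> -` {x} \<inter> D"
  have "of_nat n \<le> (\<Sum>\<^sub>\<infinity>y\<in>?A. 1 :: ennreal)" for n
  proof -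
    obtain F where F: "F \<subseteq> ?A" "finite F" "card F = n"
      using infinite_arbitrarily_large[OF False] by blast
    have "of_nat n = (\<Sum>\<^sub>\<infinity>y\<in>F. 1 :: ennreal)" using F by simp
    also have "\<dots> \<le> (\<Sum>\<^sub>\<infinity>y\<in>?A. 1)"
      using F by (intro infsum_mono_neutral nonneg_summable_on_complete) auto
    finally show ?thesis .
  qed
  then have "(\<Sum>\<^sub>\<infinity>y\<in>?A. 1 :: ennreal) = \<infinity>"
    using ennreal_Ex_less_of_nat by (metis infinity_ennreal_def leD less_top)
  then show ?thesis using False by (simp add: fibre_card_def fibre_sum_def)
qed

theorem theorem1p8:
  fixes M :: "'a measure" and R :: "('a \<times> 'a) set" and \<tau> :: "'a \<Rightarrow> 'a"
  assumes "standard_prob_space M"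
    and "countable_mp_equiv M R"
    and "\<tau> \<in> M \<rightarrow>\<^sub>M M"
    and "AE x in M. (x, \<tau> x) \<in> R"
  shows "\<forall>D\<in>sets M. (AE x in M. x \<in> D) \<longrightarrow> (\<forall>x\<in>D. (x, \<tau> x) \<in> R) \<longrightarrow>
           (\<forall>f :: 'a \<Rightarrow> ennreal. f \<in> borel_measurable M \<longrightarrow>
              fibre_sum D \<tau> f \<in> borel_measurable (completion M) \<and>
              (\<integral>\<^sup>+x. f x \<partial>M) = (\<integral>\<^sup>+x. fibre_sum D \<tau> f x \<partial>M)) \<and>
           (\<integral>\<^sup>+x. fibre_card D \<tau> x \<partial>M) = 1"
proof (intro ballI impI)
  fix D assume D: "D \<in> sets M" "AE x in M. x \<in> D" "\<forall>x\<in>D. (x, \<tau> x) \<in> R"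
  interpret prob_space M using assms(1) by (simp add: standard_prob_space_def)
  have borel: "standard_borel M" using assms(1) by (simp add: standard_prob_space_def)
  obtain h :: "'a \<Rightarrow> real" where h: "h \<in> M \<rightarrow>\<^sub>M borel" "inj_on h (space M)" "\<And>x. 0 \<le> h x" "\<And>x. h x \<le> 1"
    using standard_borel_embedding[OF borel] by blast
  obtain p :: "(nat \<Rightarrow> nat) \<Rightarrow> 'a" where p: "p \<in> borel \<rightarrow>\<^sub>M M" "space M \<subseteq> range p"
    using standard_borel_parametrization[OF borel not_empty] by blast
  interpret coded_mp_equiv M h p R
    by unfold_locales (use h p assms(2) in auto)
  have main: "fibre_sum D \<tau> f \<in> borel_measurable (completion M) \<and>
      (\<integral>\<^sup>+x. f x \<partial>M) = (\<integral>\<^sup>+x. fibre_sum D \<tau> f x \<partial>M)"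
    if f: "f \<in> borel_measurable M" for f :: "'a \<Rightarrow> ennreal"
  proof -
    obtain g where g: "g \<in> borel_measurable M" "AE y in M. fibre_sum D \<tau> f y = g y"
      "(\<integral>\<^sup>+x. f x \<partial>M) = (\<integral>\<^sup>+y. g y \<partial>M)"
      using fibre_sum_AE_eq[OF D(1) assms(3) _ D(2) f] D(3) by metis
    have "fibre_sum D \<tau> f \<in> borel_measurable (completion M)"
      by (rule measurable_completion_AE[OF g(1) _ g(2)]) simp
    moreover have "(\<integral>\<^sup>+y. g y \<partial>M) = (\<integral>\<^sup>+x. fibre_sum D \<tau> f x \<partial>M)"
      using g(2) by (intro nn_integral_cong_AE) (auto elim: eventually_mono)
    ultimately show ?thesis using g(3) by simp
  qed
  have "(\<integral>\<^sup>+x. fibre_card D \<tau> x \<partial>M) = 1"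
    using main[of "\<lambda>_. 1"] by (simp add: fibre_card_eq_fibre_sum emeasure_space_1)
  with main show "(\<forall>f :: 'a \<Rightarrow> ennreal. f \<in> borel_measurable M \<longrightarrow>
              fibre_sum D \<tau> f \<in> borel_measurable (completion M) \<and>
              (\<integral>\<^sup>+x. f x \<partial>M) = (\<integral>\<^sup>+x. fibre_sum D \<tau> f x \<partial>M)) \<and>
           (\<integral>\<^sup>+x. fibre_card D \<tau> x \<partial>M) = 1"
    by blast
qed

end
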